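(* Let $\alpha>1$ and let $(X_i)_{i\ge1}$ be i.i.d. real-valued random variables, with generic copy $X$, such that $\mathbf{E}X=0$, $$\mathbf{P}(X>x)=x^{-\alpha}L_+(x)\quad (x>0)$$ for a slowly varying function $L_+$, and $$\limsup_{x\to\infty}\frac{\mathbf{P}(X<-x)}{\mathbf{P}(X>x)}\in[0,\infty).$$ Let $S_k=\sum_{i=1}^kX_i$. Then for every $0<a<b<\infty$ with $\mathbf{P}(X\in(a,b))>0$, $$\lim_{n\to\infty}\frac{1}{(\log n)^2}\log\mathbf{P}\Big(k^{-1}S_k\in[a,b]\ \text{ for all } k\in\{1,2,\ldots,n\}\Big)=-\frac{\alpha-1}{2(\log b-\log a)}.$$
   Context: A measurable function $L:(0,\infty)\to(0,\infty)$ is slowly varying if $\lim_{x\to\infty}L(tx)/L(x)=1$ for every $t>0$. *)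

theory Defs
  imports "HOL-Probability.Probability"
begin

(* Only the values of L on the open half-line matter; outside of it L is arbitrary. *)
definition slowly_varying :: "(real \<Rightarrow> real) \<Rightarrow> bool" where
  "slowly_varying L \<longleftrightarrow>
     L \<in> borel_measurable (restrict_space borel {0<..}) \<and>
     (\<forall>x>0. L x > 0) \<and>
     (\<forall>t>0. ((\<lambda>x. L (t * x) / L x) \<longlongrightarrow> 1) at_top)"

(* Identically distributed and independent along the index set I; measurability of each
   X i (i in I) is part of indep_vars. *)
definition iid_on :: "'i set \<Rightarrow> 'a measure \<Rightarrow> ('i \<Rightarrow> 'a \<Rightarrow> real) \<Rightarrow> bool" where
  "iid_on I M X \<longleftrightarrow>
     prob_space.indep_vars M (\<lambda>_. borel) X I \<and>
     (\<forall>i\<in>I. \<forall>j\<in>I. distr M borel (X i) = distr M borel (X j))"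

end

theory Submission
  imports Defs "HOL-Real_Asymp.Real_Asymp"
begin

text \<open>
  Since X has mean zero, the walk S does not move on the scale k during a time of order k, apart from
  its big jumps. Without a jump the average S(k)/k therefore decays like 1/k, and it falls from b to a
  while k grows by the factor b/a. To stay in [a,b] the walk needs about one jump of order t in each
  interval [t, (b/a) t]. Such a jump can occur at any of order t times and has size of order t, so
  it costs t^(1-alpha) up to slowly varying factors. The number of these intervals up to n is
  J = log n / log(b/a), and multiplying the costs at t = (b/a)^j for j < J gives
  -(alpha-1) log(b/a) J^2/2 = -(alpha-1) (log n)^2 / (2 log(b/a)) for the logarithm.

  The upper bound uses a ratio q slightly larger than b/a: then S must gain a positive multiple of t
  between t and q t. These increments are independent, and maximal_inequality_heavy_tail bounds the
  probability of each by C t^(1-beta) for every beta < alpha (persistence_step_upper).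

  The lower bound uses a ratio \<rho> slightly smaller than b/a and a strategy: S(t)/t lies in a window
  [w,w'] below b, exactly one jump of a suitable size occurs late in the block up to \<rho> t, and all other
  partial sums stay small. This brings S(\<rho> t)/(\<rho> t) back to the window and has conditional probability
  at least C t^(1-beta) for every beta > alpha (persistence_step_lower). The same maximal inequality,
  applied to X and -X, keeps the other partial sums small with probability at least 1/2.

  Both one-step estimates are iterated in ln_product_le and ln_product_ge. Letting q and \<rho>
  tend to b/a and beta to alpha yields the limit (log_persistence_tendsto). Slow variation enters
  through polynomial bounds x^(-alpha+-epsilon) on the tail and through the ratio of tails at
  proportional arguments.
\<close>

section \<open>Sequences of i.i.d. real random variables\<close>

locale iid_sequence = prob_space M for M :: "'a measure" +
  fixes X :: "nat \<Rightarrow> 'a \<Rightarrow> real"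
  assumes iid: "iid_on {1..} M X"
begin

lemma indep: "indep_vars (\<lambda>_. borel) X {1..}"
  using iid by (simp add: iid_on_def)

lemma measurable_X: "i \<ge> 1 \<Longrightarrow> X i \<in> borel_measurable M"
  using indep unfolding indep_vars_def2 by simp

lemma measurable_X1 [measurable]: "X 1 \<in> borel_measurable M"
  "X (Suc 0) \<in> borel_measurable M"
  by (simp_all add: measurable_X)

lemma distr_X: "i \<ge> 1 \<Longrightarrow> distr M borel (X i) = distr M borel (X 1)"
  using iid unfolding iid_on_def by (metis atLeast_iff order_refl)

lemma prob_X:
  assumes "i \<ge> 1" "B \<in> sets borel"
  shows "prob {\<omega> \<in> space M. X i \<omega> \<in> B} = prob {\<omega> \<in> space M. X 1 \<omega> \<in> B}"
proof -
  have *: "prob {\<omega> \<in> space M. X j \<omega> \<in> B} = measure (distr M borel (X j)) B" if "j \<ge> 1" for j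
    using assms(2) measurable_X[OF that]
    by (subst measure_distr) (auto intro!: arg_cong[where f=prob])
  show ?thesis
    unfolding *[OF assms(1)] *[OF order_refl] distr_X[OF assms(1)] ..
qed

lemma expectation_X:
  assumes "i \<ge> 1" "f \<in> borel_measurable borel"
  shows "expectation (\<lambda>\<omega>. f (X i \<omega>)) = (expectation (\<lambda>\<omega>. f (X 1 \<omega>)) :: real)"
proof -
  have *: "expectation (\<lambda>\<omega>. f (X j \<omega>)) = (\<integral>x. f x \<partial>distr M borel (X j))" if "j \<ge> 1" for j
    by (rule integral_distr[OF measurable_X[OF that] assms(2), symmetric])
  show ?thesis
    unfolding *[OF assms(1)] *[OF order_refl] distr_X[OF assms(1)] ..
qed

text \<open>
  Events are given as predicates on whole sequences, because sums over index sets are easier to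
  state there than on a product space; the conditions on restrict say that only the coordinates
  in the block matter.
\<close>
lemma prob_conj_disjoint_blocks:
  assumes AB: "A \<subseteq> {1..}" "B \<subseteq> {1..}" "A \<inter> B = {}"
    and P: "{f \<in> space (PiM A (\<lambda>_. borel)). P f} \<in> sets (PiM A (\<lambda>_. borel))"
      "\<And>f. P (restrict f A) = P f"
    and Q: "{f \<in> space (PiM B (\<lambda>_. borel)). Q f} \<in> sets (PiM B (\<lambda>_. borel))"
      "\<And>f. Q (restrict f B) = Q f"
  shows "prob {\<omega> \<in> space M. P (\<lambda>i. X i \<omega>) \<and> Q (\<lambda>i. X i \<omega>)}
    = prob {\<omega> \<in> space M. P (\<lambda>i. X i \<omega>)} * prob {\<omega> \<in> space M. Q (\<lambda>i. X i \<omega>)}"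
proof -
  let ?XA = "{f \<in> space (PiM A (\<lambda>_. borel)). P f}"
  let ?XB = "{f \<in> space (PiM B (\<lambda>_. borel)). Q f}"
  let ?rA = "\<lambda>\<omega>. restrict (\<lambda>i. X i \<omega>) A"
  let ?rB = "\<lambda>\<omega>. restrict (\<lambda>i. X i \<omega>) B"
  have "prob ((\<lambda>x. (?rA x, ?rB x)) -` (?XA \<times> ?XB) \<inter> space M)
      = prob (?rA -` ?XA \<inter> space M) * prob (?rB -` ?XB \<inter> space M)"
    by (rule indep_varD[OF indep_var_restrict[OF indep AB(3,1,2)] P(1) Q(1)])
  moreover have "?rA -` ?XA \<inter> space M = {\<omega> \<in> space M. P (\<lambda>i. X i \<omega>)}"
    using P(2) by (auto simp: space_PiM)
  moreover have "?rB -` ?XB \<inter> space M = {\<omega> \<in> space M. Q (\<lambda>i. X i \<omega>)}"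
    using Q(2) by (auto simp: space_PiM)
  moreover have "(\<lambda>x. (?rA x, ?rB x)) -` (?XA \<times> ?XB) \<inter> space M
      = {\<omega> \<in> space M. P (\<lambda>i. X i \<omega>) \<and> Q (\<lambda>i. X i \<omega>)}"
    using P(2) Q(2) by (auto simp: space_PiM)
  ultimately show ?thesis by simp
qed

lemma sets_PiM_sum:
  assumes "F \<subseteq> A" "C \<in> sets (borel :: real measure)"
  shows "{f \<in> space (PiM A (\<lambda>_. borel :: real measure)). (\<Sum>i\<in>F. f i) \<in> C}
    \<in> sets (PiM A (\<lambda>_. borel))"
proof -
  have "(\<lambda>f. \<Sum>i\<in>F. f i) \<in> borel_measurable (PiM A (\<lambda>_. borel :: real measure))"
    by (rule borel_measurable_sum) (use assms in auto)
  from measurable_sets[OF this assms(2)] show ?thesis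
    by (simp add: vimage_def Int_def conj_commute)
qed

lemma sets_sum:
  assumes "F \<subseteq> {1..}" "C \<in> sets (borel :: real measure)"
  shows "{\<omega> \<in> space M. (\<Sum>i\<in>F. X i \<omega>) \<in> C} \<in> sets M"
proof -
  have "(\<lambda>\<omega>. \<Sum>i\<in>F. X i \<omega>) \<in> borel_measurable M"
    by (rule borel_measurable_sum) (use assms measurable_X in auto)
  from measurable_sets[OF this assms(2)] show ?thesis
    by (simp add: vimage_def Int_def conj_commute)
qed

lemma iid_sequence_uminus: "iid_sequence M (\<lambda>i \<omega>. - X i \<omega>)"
proof
  have "indep_vars (\<lambda>_. borel) (\<lambda>i \<omega>. - X i \<omega>) {1..}"
    by (rule indep_vars_compose2[OF indep]) auto
  moreover have "distr M borel (\<lambda>\<omega>. - X i \<omega>) = distr M borel (\<lambda>\<omega>. - X 1 \<omega>)" if "i \<ge> 1" for i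
  proof -
    have *: "distr M borel (\<lambda>\<omega>. - X j \<omega>) = distr (distr M borel (X j)) borel uminus" if "j \<ge> 1" for j
      by (subst distr_distr[OF _ measurable_X[OF that]]) (simp_all add: comp_def)
    show ?thesis unfolding *[OF that] *[OF order_refl] distr_X[OF that] ..
  qed
  ultimately show "iid_on {1..} M (\<lambda>i \<omega>. - X i \<omega>)"
    unfolding iid_on_def by (metis atLeast_iff)
qed

end

section \<open>Polynomial bounds for regularly varying tails\<close>

text \<open>
  A one-sided Potter bound. Far out, doubling the argument multiplies x^beta G(x) by a factor at
  most 1, so the values on one dyadic interval, where G is at most 1, bound all later ones.
\<close>
lemma regularly_varying_upper:
  fixes G :: "real \<Rightarrow> real"
  assumes pos: "\<And>x. x > 0 \<Longrightarrow> G x > 0" and le1: "\<And>x. G x \<le> 1"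
    and lim: "((\<lambda>x. G (2 * x) / G x) \<longlongrightarrow> 2 powr (- \<alpha>)) at_top"
    and \<beta>: "0 < \<beta>" "\<beta> < \<alpha>"
  shows "\<exists>C>0. \<exists>x0. \<forall>x\<ge>x0. G x \<le> C * x powr (- \<beta>)"
proof -
  have "\<forall>\<^sub>F x in at_top. G (2 * x) / G x < 2 powr (- \<beta>)"
    using \<beta> by (intro order_tendstoD(2)[OF lim]) simp
  then obtain x0' where x0': "\<And>x. x \<ge> x0' \<Longrightarrow> G (2 * x) / G x < 2 powr (- \<beta>)"
    by (auto simp: eventually_at_top_linorder)
  define x0 where "x0 = max 1 x0'"
  have x0: "x0 \<ge> 1" "\<And>x. x \<ge> x0 \<Longrightarrow> G (2 * x) \<le> 2 powr (- \<beta>) * G x"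
  proof -
    show "x0 \<ge> 1" by (simp add: x0_def)
    fix x assume "x \<ge> x0"
    then have "x \<ge> x0'" "x > 0" by (auto simp: x0_def)
    from x0'[OF this(1)] pos[OF this(2)] show "G (2 * x) \<le> 2 powr (- \<beta>) * G x"
      by (simp add: divide_less_eq)
  qed
  define C where "C = (2 * x0) powr \<beta>"
  have bound: "\<forall>x. x0 \<le> x \<and> x \<le> 2 ^ Suc n * x0 \<longrightarrow> x powr \<beta> * G x \<le> C" for n
  proof (induction n)
    case 0
    show ?case
    proof (intro allI impI)
      fix x assume x: "x0 \<le> x \<and> x \<le> 2 ^ Suc 0 * x0"
      have "x powr \<beta> * G x \<le> x powr \<beta> * 1"
        by (intro mult_left_mono le1) auto
      also have "\<dots> \<le> C"
        unfolding C_def using x x0(1) \<beta> by (auto intro!: powr_mono2)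
      finally show "x powr \<beta> * G x \<le> C" .
    qed
  next
    case (Suc n)
    show ?case
    proof (intro allI impI)
      fix x assume x: "x0 \<le> x \<and> x \<le> 2 ^ Suc (Suc n) * x0"
      show "x powr \<beta> * G x \<le> C"
      proof (cases "x \<le> 2 * x0")
        case True
        have "2 * x0 \<le> 2 ^ Suc n * x0"
          using x0(1) by simp
        then show ?thesis using Suc.IH x True by auto
      next
        case False
        have half: "(x / 2) powr \<beta> = x powr \<beta> * 2 powr (- \<beta>)"
          using False x0(1) by (simp add: powr_divide powr_minus_divide)
        have "G (2 * (x / 2)) \<le> 2 powr (- \<beta>) * G (x / 2)"
          using False by (intro x0(2)) auto
        then have "x powr \<beta> * G x \<le> x powr \<beta> * (2 powr (- \<beta>) * G (x / 2))"
          by (intro mult_left_mono) auto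
        also have "\<dots> = (x / 2) powr \<beta> * G (x / 2)"
          using False x0(1) by (simp add: half)
        also have "\<dots> \<le> C"
          using Suc.IH False x by auto
        finally show ?thesis .
      qed
    qed
  qed
  have "G x \<le> C * x powr (- \<beta>)" if "x \<ge> x0" for x
  proof -
    obtain n :: nat where "x / x0 < 2 ^ n"
      using real_arch_pow[of 2 "x / x0"] by auto
    then have "x \<le> 2 ^ n * x0"
      using x0(1) by (simp add: divide_less_eq)
    also have "\<dots> \<le> 2 ^ Suc n * x0"
      using x0(1) by simp
    finally have "x powr \<beta> * G x \<le> C"
      using bound[of n] that by auto
    then show ?thesis
      using that x0(1) by (simp add: powr_minus_divide pos_le_divide_eq pos_divide_le_eq mult.commute)
  qed
  moreover have "C > 0" using x0(1) by (simp add: C_def)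
  ultimately show ?thesis by blast
qed

lemma regularly_varying_lower:
  fixes G :: "real \<Rightarrow> real"
  assumes pos: "\<And>x. x > 0 \<Longrightarrow> G x > 0" and mono: "\<And>x y. x \<le> y \<Longrightarrow> G y \<le> G x"
    and lim: "((\<lambda>x. G (2 * x) / G x) \<longlongrightarrow> 2 powr (- \<alpha>)) at_top"
    and \<beta>: "0 < \<beta>" "\<alpha> < \<beta>"
  shows "\<exists>c>0. \<exists>x0. \<forall>x\<ge>x0. c * x powr (- \<beta>) \<le> G x"
proof -
  have "\<forall>\<^sub>F x in at_top. G (2 * x) / G x > 2 powr (- \<beta>)"
    using \<beta> by (intro order_tendstoD(1)[OF lim]) simp
  then obtain x0' where x0': "\<And>x. x \<ge> x0' \<Longrightarrow> G (2 * x) / G x > 2 powr (- \<beta>)"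
    by (auto simp: eventually_at_top_linorder)
  define x0 where "x0 = max 1 x0'"
  have x0: "x0 \<ge> 1" "\<And>x. x \<ge> x0 \<Longrightarrow> G (2 * x) \<ge> 2 powr (- \<beta>) * G x"
  proof -
    show "x0 \<ge> 1" by (simp add: x0_def)
    fix x assume "x \<ge> x0"
    then have "x \<ge> x0'" "x > 0" by (auto simp: x0_def)
    from x0'[OF this(1)] pos[OF this(2)] show "G (2 * x) \<ge> 2 powr (- \<beta>) * G x"
      by (simp add: less_divide_eq)
  qed
  define c where "c = x0 powr \<beta> * G (2 * x0)"
  have c: "c > 0" using x0(1) pos by (simp add: c_def)
  have bound: "\<forall>x. x0 \<le> x \<and> x \<le> 2 ^ Suc n * x0 \<longrightarrow> c \<le> x powr \<beta> * G x" for n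
  proof (induction n)
    case 0
    show ?case
      unfolding c_def using x0(1) \<beta> pos[of "2 * x0"] by (auto intro!: mult_mono powr_mono2 mono)
  next
    case (Suc n)
    show ?case
    proof (intro allI impI)
      fix x assume x: "x0 \<le> x \<and> x \<le> 2 ^ Suc (Suc n) * x0"
      show "c \<le> x powr \<beta> * G x"
      proof (cases "x \<le> 2 * x0")
        case True
        have "2 * x0 \<le> 2 ^ Suc n * x0"
          using x0(1) by simp
        then show ?thesis using Suc.IH x True by auto
      next
        case False
        have half: "(x / 2) powr \<beta> = x powr \<beta> * 2 powr (- \<beta>)"
          using False x0(1) by (simp add: powr_divide powr_minus_divide)
        have "c \<le> (x / 2) powr \<beta> * G (x / 2)"
          using Suc.IH False x by auto
        also have "\<dots> = x powr \<beta> * (2 powr (- \<beta>) * G (x / 2))"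
          using False x0(1) by (simp add: half)
        also have "\<dots> \<le> x powr \<beta> * G (2 * (x / 2))"
          using False by (intro mult_left_mono x0(2)) auto
        finally show ?thesis by simp
      qed
    qed
  qed
  have "c * x powr (- \<beta>) \<le> G x" if "x \<ge> x0" for x
  proof -
    obtain n :: nat where "x / x0 < 2 ^ n"
      using real_arch_pow[of 2 "x / x0"] by auto
    then have "x \<le> 2 ^ n * x0"
      using x0(1) by (simp add: divide_less_eq)
    also have "\<dots> \<le> 2 ^ Suc n * x0"
      using x0(1) by simp
    finally have "c \<le> x powr \<beta> * G x"
      using bound[of n] that by auto
    then show ?thesis
      using that x0(1) by (simp add: powr_minus_divide pos_le_divide_eq pos_divide_le_eq mult.commute)
  qed
  with c show ?thesis by blast
qed

section \<open>A maximal inequality for sums with a heavy right tail\<close>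

lemma exp_le_quadratic:
  fixes x :: real
  assumes "x \<le> 1"
  shows "exp x \<le> 1 + x + \<bar>x\<bar> * min 1 \<bar>x\<bar>"
proof (cases "x \<ge> 0")
  case True
  then show ?thesis using exp_bound[of x] assms by (simp add: min_def power2_eq_square)
next
  case neg: False
  show ?thesis
  proof (cases "x \<ge> -1")
    case True
    have "exp x = 1 / exp (- x)" by (simp add: exp_minus divide_inverse)
    also have "\<dots> \<le> 1 / (1 - x)"
      using neg exp_ge_add_one_self[of "- x"] by (intro divide_left_mono) auto
    also have "\<dots> \<le> 1 + x + x\<^sup>2"
    proof -
      have "(1 + x + x\<^sup>2) * (1 - x) = 1 - x ^ 3"
        by (simp add: algebra_simps power2_eq_square power3_eq_cube)
      moreover have "x ^ 3 \<le> 0" using neg by (simp add: power_le_zero_eq)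
      ultimately show ?thesis using neg by (simp add: pos_divide_le_eq)
    qed
    finally show ?thesis using neg True by (simp add: min_def power2_eq_square)
  next
    case False
    then show ?thesis using neg by (simp add: min_def)
  qed
qed

text \<open>
  Below the level 1/l the exponential is compared with its quadratic Taylor bound, whose linear term
  has mean zero; above that level it is replaced by its largest possible value exp(l y). Taking the
  minimum with 1 in the quadratic term keeps it integrable for every integrable variable.
\<close>
lemma (in prob_space) mgf_truncated_le:
  fixes Y :: "'a \<Rightarrow> real"
  assumes int: "integrable M Y" and mean: "expectation Y = 0" and l: "l > 0"
  shows "expectation (\<lambda>\<omega>. exp (l * min (Y \<omega>) y))
    \<le> 1 + l * expectation (\<lambda>\<omega>. \<bar>Y \<omega>\<bar> * min 1 (l * \<bar>Y \<omega>\<bar>))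
        + exp (l * y) * prob {\<omega> \<in> space M. Y \<omega> > 1 / l}"
proof -
  have [measurable]: "Y \<in> borel_measurable M" using int by auto
  have int1: "integrable M (\<lambda>\<omega>. \<bar>Y \<omega>\<bar> * min 1 (l * \<bar>Y \<omega>\<bar>))"
  proof (rule Bochner_Integration.integrable_bound[OF int])
    show "AE \<omega> in M. norm (\<bar>Y \<omega>\<bar> * min 1 (l * \<bar>Y \<omega>\<bar>)) \<le> norm (Y \<omega>)"
      using l by (auto simp: abs_mult intro!: mult_left_le)
  qed measurable
  let ?g = "\<lambda>\<omega>. 1 + l * Y \<omega> + l * (\<bar>Y \<omega>\<bar> * min 1 (l * \<bar>Y \<omega>\<bar>))
        + exp (l * y) * indicator {\<omega> \<in> space M. Y \<omega> > 1 / l} \<omega>"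
  have ind: "integrable M (indicator {\<omega> \<in> space M. Y \<omega> > 1 / l} :: 'a \<Rightarrow> real)"
    by (intro integrable_real_indicator) (auto simp: emeasure_eq_measure)
  have "expectation (\<lambda>\<omega>. exp (l * min (Y \<omega>) y)) \<le> expectation ?g"
  proof (rule integral_mono)
    show "integrable M (\<lambda>\<omega>. exp (l * min (Y \<omega>) y))"
      using l by (intro integrable_const_bound[where B="exp (l * y)"]) auto
    show "integrable M ?g"
      using int int1 ind by (intro Bochner_Integration.integrable_add integrable_mult_right) auto
  next
    fix \<omega> assume \<omega>: "\<omega> \<in> space M"
    show "exp (l * min (Y \<omega>) y) \<le> ?g \<omega>"
    proof (cases "Y \<omega> > 1 / l")
      case True
      then have "Y \<omega> > 0" using l by (meson less_trans zero_less_divide_1_iff)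
      then have "0 \<le> l * Y \<omega>" "0 \<le> l * (\<bar>Y \<omega>\<bar> * min 1 (l * \<bar>Y \<omega>\<bar>))" using l by auto
      moreover have "exp (l * min (Y \<omega>) y) \<le> exp (l * y)" using l by auto
      moreover have "indicator {\<omega> \<in> space M. Y \<omega> > 1 / l} \<omega> = (1 :: real)"
        using True \<omega> by simp
      ultimately show ?thesis by (simp only: mult_1_right)
    next
      case False
      then have le: "l * Y \<omega> \<le> 1" using l by (simp add: field_simps)
      have "exp (l * min (Y \<omega>) y) \<le> exp (l * Y \<omega>)" using l by auto
      also have "\<dots> \<le> 1 + l * Y \<omega> + \<bar>l * Y \<omega>\<bar> * min 1 \<bar>l * Y \<omega>\<bar>"
        by (rule exp_le_quadratic[OF le])
      also have "\<dots> = 1 + l * Y \<omega> + l * (\<bar>Y \<omega>\<bar> * min 1 (l * \<bar>Y \<omega>\<bar>))"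
        using l by (simp add: abs_mult)
      finally show ?thesis using False by simp
    qed
  qed
  also have "expectation ?g = 1 + l * expectation (\<lambda>\<omega>. \<bar>Y \<omega>\<bar> * min 1 (l * \<bar>Y \<omega>\<bar>))
        + exp (l * y) * prob {\<omega> \<in> space M. Y \<omega> > 1 / l}"
    using int int1 ind mean
    by (simp add: prob_space)
  finally show ?thesis .
qed

text \<open>
  The error term of the previous bound is o(1) by dominated convergence, with no rate. This suffices:
  below it multiplies a logarithm, and so changes a polynomial exponent by an arbitrarily small amount.
\<close>
lemma (in prob_space) truncated_second_moment_tendsto_0:
  fixes Y :: "'a \<Rightarrow> real"
  assumes int: "integrable M Y" and l: "l \<longlonglongrightarrow> (0 :: real)" "\<And>n. l n \<ge> 0"
  shows "(\<lambda>n. expectation (\<lambda>\<omega>. \<bar>Y \<omega>\<bar> * min 1 (l n * \<bar>Y \<omega>\<bar>))) \<longlonglongrightarrow> 0"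
proof -
  have [measurable]: "Y \<in> borel_measurable M" using int by auto
  have "(\<lambda>n. expectation (\<lambda>\<omega>. \<bar>Y \<omega>\<bar> * min 1 (l n * \<bar>Y \<omega>\<bar>))) \<longlonglongrightarrow> expectation (\<lambda>\<omega>. 0)"
  proof (rule integral_dominated_convergence[where w="\<lambda>\<omega>. \<bar>Y \<omega>\<bar>"])
    show "integrable M (\<lambda>\<omega>. \<bar>Y \<omega>\<bar>)" using int by simp
    show "AE \<omega> in M. (\<lambda>n. \<bar>Y \<omega>\<bar> * min 1 (l n * \<bar>Y \<omega>\<bar>)) \<longlonglongrightarrow> 0"
    proof (intro always_eventually allI)
      fix \<omega>
      have "(\<lambda>n. \<bar>Y \<omega>\<bar> * min 1 (l n * \<bar>Y \<omega>\<bar>)) \<longlonglongrightarrow> \<bar>Y \<omega>\<bar> * min 1 (0 * \<bar>Y \<omega>\<bar>)"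
        by (intro tendsto_intros l)
      then show "(\<lambda>n. \<bar>Y \<omega>\<bar> * min 1 (l n * \<bar>Y \<omega>\<bar>)) \<longlonglongrightarrow> 0" by simp
    qed
    show "AE \<omega> in M. norm (\<bar>Y \<omega>\<bar> * min 1 (l n * \<bar>Y \<omega>\<bar>)) \<le> \<bar>Y \<omega>\<bar>" for n
      using l(2)[of n] by (auto simp: abs_mult intro!: mult_left_le)
  qed measurable
  then show ?thesis by simp
qed

context iid_sequence
begin

lemma chernoff_truncated:
  assumes B: "B \<subseteq> {1..}" "finite B" "card B \<le> m" and l: "l > 0"
    and mgf: "expectation (\<lambda>\<omega>. exp (l * min (X 1 \<omega>) y)) \<le> exp v" "v \<ge> 0"
  shows "prob {\<omega> \<in> space M. (\<Sum>i\<in>B. min (X i \<omega>) y) \<ge> x} \<le> exp (real m * v - l * x)"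
proof -
  have [measurable]: "X i \<in> borel_measurable M" if "i \<in> B" for i
    by (rule measurable_X) (use B that in auto)
  let ?u = "\<lambda>\<omega>. \<Prod>i\<in>B. exp (l * min (X i \<omega>) y)"
  have u: "?u \<omega> = exp (l * (\<Sum>i\<in>B. min (X i \<omega>) y))" for \<omega>
    using B(2) by (simp add: exp_sum sum_distrib_left)
  have ind: "indep_vars (\<lambda>_. borel) (\<lambda>i \<omega>. exp (l * min (X i \<omega>) y)) B"
    by (rule indep_vars_compose2[OF indep_vars_subset[OF indep B(1)]]) measurable
  have int: "integrable M (\<lambda>\<omega>. exp (l * min (X i \<omega>) y))" if "i \<in> B" for i
    using l that by (intro integrable_const_bound[where B="exp (l * y)"]) auto
  have "prob {\<omega> \<in> space M. (\<Sum>i\<in>B. min (X i \<omega>) y) \<ge> x} = prob {\<omega> \<in> space M. ?u \<omega> \<ge> exp (l * x)}"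
    unfolding u using l by simp
  also have "\<dots> \<le> expectation ?u / exp (l * x)"
  proof (rule integral_Markov_inequality_measure)
    show "integrable M ?u" by (rule indep_vars_integrable[OF B(2) ind int])
    show "AE \<omega> in M. 0 \<le> ?u \<omega>" by (simp add: prod_nonneg)
  qed auto
  also have "expectation ?u = (\<Prod>i\<in>B. expectation (\<lambda>\<omega>. exp (l * min (X i \<omega>) y)))"
    by (rule indep_vars_lebesgue_integral[OF B(2) ind int])
  also have "\<dots> = (\<Prod>i\<in>B. expectation (\<lambda>\<omega>. exp (l * min (X 1 \<omega>) y)))"
    using B(1) by (intro prod.cong refl expectation_X[where f="\<lambda>t. exp (l * min t y)"]) auto
  also have "\<dots> = expectation (\<lambda>\<omega>. exp (l * min (X 1 \<omega>) y)) ^ card B" by simp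
  also have "\<dots> \<le> exp v ^ card B" by (intro power_mono mgf) (simp add: integral_nonneg)
  also have "\<dots> = exp (real (card B) * v)" by (simp add: exp_of_nat_mult)
  also have "\<dots> \<le> exp (real m * v)" using B(3) mgf(2) by (simp add: mult_right_mono)
  finally show ?thesis by (simp add: exp_diff divide_right_mono)
qed

text \<open>
  A large sum is due to one large summand. Either some summand exceeds delta m, which costs
  m m^(-beta), or the sum of the truncated variables is large, and then the exponential Markov
  inequality with parameter l = K ln m / m gives the bound exp(1) m^(-(1+beta)) for each single sum.
  The latter is small enough for a union bound over m different sums. The sums range over an
  arbitrary family of subsets, so that partial sums with a missing term are covered as well as
  sums over a block.
\<close>
lemma maximal_inequality_heavy_tail:
  assumes int: "integrable M (X 1)" and mean: "expectation (X 1) = 0"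
    and tail: "\<And>x. x \<ge> x0 \<Longrightarrow> prob {\<omega> \<in> space M. X 1 \<omega> > x} \<le> D * x powr (- \<beta>)"
    and \<beta>: "\<beta> > 1" and c: "c > 0"
  shows "\<exists>C>0. \<forall>\<^sub>F m in sequentially. \<forall>A \<B>. A \<subseteq> {1..} \<longrightarrow> finite A \<longrightarrow> card A \<le> m \<longrightarrow>
    \<B> \<subseteq> Pow A \<longrightarrow> card \<B> \<le> m \<longrightarrow>
    prob {\<omega> \<in> space M. \<exists>B\<in>\<B>. (\<Sum>i\<in>B. X i \<omega>) \<ge> c * real m} \<le> C * real m powr (1 - \<beta>)"
proof -
  \<comment> \<open>K makes exp(-l c m) = m^(-2(1+beta)), half of which pays for the moment generating function; delta keeps the factor exp(l delta m) = m^((beta-1)/2) below m^(beta-1).\<close>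
  define K where "K = 2 * (1 + \<beta>) / c"
  define \<delta> where "\<delta> = (\<beta> - 1) / (2 * K)"
  define l where "l m = K * ln (real m) / real m" for m :: nat
  define h where "h m = expectation (\<lambda>\<omega>. \<bar>X 1 \<omega>\<bar> * min 1 (l m * \<bar>X 1 \<omega>\<bar>))" for m
  define D' where "D' = max D 1"
  define C where "C = exp 1 + D' * \<delta> powr (- \<beta>)"
  have K: "K > 0" using \<beta> c by (simp add: K_def)
  have \<delta>: "\<delta> > 0" using \<beta> K by (simp add: \<delta>_def)
  have D': "D' > 0" by (simp add: D'_def)
  have K\<delta>: "\<delta> * K = (\<beta> - 1) / 2" using K by (simp add: \<delta>_def)
  have tail': "prob {\<omega> \<in> space M. X 1 \<omega> > x} \<le> D' * x powr (- \<beta>)" if "x \<ge> x0" for x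
  proof -
    have "D * x powr (- \<beta>) \<le> D' * x powr (- \<beta>)" by (intro mult_right_mono) (auto simp: D'_def)
    with tail[OF that] show ?thesis by simp
  qed
  have "C > 0" using D' \<delta> by (simp add: C_def add_pos_pos)
  moreover have "l \<longlonglongrightarrow> 0" unfolding l_def using K by real_asymp
  moreover have "l m \<ge> 0" for m
    using K by (cases "m = 0") (auto simp: l_def)
  ultimately have "C > 0" "h \<longlonglongrightarrow> 0" unfolding h_def
    by (auto intro!: truncated_second_moment_tendsto_0 int[unfolded One_nat_def])
  then have "\<forall>\<^sub>F m in sequentially. h m < c / 2" using c by (intro order_tendstoD(2)) auto
  moreover note \<open>C > 0\<close>
  moreover have "filterlim (\<lambda>m. real m / (K * ln (real m))) at_top sequentially"
    using K by real_asymp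
  then have "\<forall>\<^sub>F m in sequentially. real m / (K * ln (real m)) \<ge> x0"
    unfolding filterlim_at_top by blast
  moreover have "filterlim (\<lambda>m. \<delta> * real m) at_top sequentially"
    using \<delta> by real_asymp
  then have "\<forall>\<^sub>F m in sequentially. \<delta> * real m \<ge> x0"
    unfolding filterlim_at_top by blast
  moreover have "(\<lambda>m. real m powr (1 + (\<beta> - 1) / 2) * (D' * (real m / (K * ln (real m))) powr (- \<beta>)))
      \<longlonglongrightarrow> 0"
  proof -
    define \<gamma> where "\<gamma> = (\<beta> - 1) / 2"
    have \<gamma>: "\<gamma> > 0" using \<beta> by (simp add: \<gamma>_def)
    have "(\<lambda>m. ln (real m) powr \<beta> * real m powr (- \<gamma>)) \<longlonglongrightarrow> 0"
      using \<gamma> by real_asymp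
    from tendsto_mult_right_zero[OF this, of "D' * K powr \<beta>"]
    show ?thesis
    proof (rule Lim_transform_eventually)
      show "\<forall>\<^sub>F m in sequentially. D' * K powr \<beta> * (ln (real m) powr \<beta> * real m powr (- \<gamma>))
        = real m powr (1 + (\<beta> - 1) / 2) * (D' * (real m / (K * ln (real m))) powr (- \<beta>))"
        using eventually_ge_at_top[of 2]
      proof eventually_elim
        case (elim m)
        have e: "1 + (\<beta> - 1) / 2 = \<beta> - \<gamma>" by (simp add: \<gamma>_def field_simps)
        have "(real m / (K * ln (real m))) powr (- \<beta>) = K powr \<beta> * ln (real m) powr \<beta> / real m powr \<beta>"
          using elim K by (simp add: powr_divide powr_mult powr_minus_divide)
        then show ?case
          unfolding e using elim by (simp add: powr_diff powr_minus divide_inverse)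
      qed
    qed
  qed
  then have "\<forall>\<^sub>F m in sequentially.
      real m powr (1 + (\<beta> - 1) / 2) * (D' * (real m / (K * ln (real m))) powr (- \<beta>)) < 1"
    by (intro order_tendstoD(2)) auto
  moreover have "\<forall>\<^sub>F m :: nat in sequentially. m \<ge> 2" by (rule eventually_ge_at_top)
  ultimately have main: "C > 0 \<and> (\<forall>\<^sub>F m in sequentially. m \<ge> 2 \<and> h m < c / 2 \<and>
      real m / (K * ln (real m)) \<ge> x0 \<and> \<delta> * real m \<ge> x0 \<and>
      real m powr (1 + (\<beta> - 1) / 2) * (D' * (real m / (K * ln (real m))) powr (- \<beta>)) < 1)"
    by (simp only: eventually_conj_iff)
  have bound: "prob {\<omega> \<in> space M. \<exists>B\<in>\<B>. (\<Sum>i\<in>B. X i \<omega>) \<ge> c * real m} \<le> C * real m powr (1 - \<beta>)"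
    if m: "m \<ge> 2" "h m < c / 2" "real m / (K * ln (real m)) \<ge> x0" "\<delta> * real m \<ge> x0"
      "real m powr (1 + (\<beta> - 1) / 2) * (D' * (real m / (K * ln (real m))) powr (- \<beta>)) < 1"
      and A: "A \<subseteq> {1..}" "finite A" "card A \<le> m" "\<B> \<subseteq> Pow A" "card \<B> \<le> m" for m A \<B>
  proof -
    have fin: "finite \<B>" using A(2,4) by (meson finite_Pow_iff finite_subset)
    have lnm: "ln (real m) > 0" using m(1) by simp
    have lpos: "l m > 0" using K lnm m(1) by (simp add: l_def)
    have linv: "1 / l m = real m / (K * ln (real m))" by (simp add: l_def)
    let ?p = "prob {\<omega> \<in> space M. X 1 \<omega> > 1 / l m}"
    define v where "v = l m * h m + real m powr (\<delta> * K) * ?p"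
    have h0: "h m \<ge> 0" unfolding h_def using lpos by (intro Bochner_Integration.integral_nonneg) auto
    have v0: "v \<ge> 0" unfolding v_def using lpos h0 by simp
    have "exp (l m * (\<delta> * real m)) = exp (\<delta> * K * ln (real m))"
      using m(1) by (simp add: l_def mult_ac)
    also have "\<dots> = real m powr (\<delta> * K)" using m(1) by (simp add: powr_def)
    finally have e1: "exp (l m * (\<delta> * real m)) = real m powr (\<delta> * K)" .
    have mgf: "expectation (\<lambda>\<omega>. exp (l m * min (X 1 \<omega>) (\<delta> * real m))) \<le> exp v"
    proof -
      have "expectation (\<lambda>\<omega>. exp (l m * min (X 1 \<omega>) (\<delta> * real m))) \<le> 1 + v"
        using mgf_truncated_le[OF int mean lpos, of "\<delta> * real m"]
        unfolding e1 v_def h_def by (simp add: algebra_simps)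
      also have "\<dots> \<le> exp v" by (rule exp_ge_add_one_self)
      finally show ?thesis .
    qed
    have mv: "real m * v \<le> (1 + \<beta>) * ln (real m) + 1"
    proof -
      have "real m * (l m * h m) = K * ln (real m) * h m" using m(1) by (simp add: l_def)
      also have "\<dots> \<le> K * ln (real m) * (c / 2)"
        using K lnm m(2) by (intro mult_left_mono) auto
      also have "\<dots> = (1 + \<beta>) * ln (real m)" using c by (simp add: K_def)
      finally have 1: "real m * (l m * h m) \<le> (1 + \<beta>) * ln (real m)" .
      have "real m * (real m powr (\<delta> * K) * ?p) = real m powr (1 + (\<beta> - 1) / 2) * ?p"
        using m(1) by (simp add: K\<delta> powr_add)
      also have "\<dots> \<le> real m powr (1 + (\<beta> - 1) / 2) * (D' * (real m / (K * ln (real m))) powr (- \<beta>))"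
        unfolding linv by (intro mult_left_mono tail' m(3)) auto
      also have "\<dots> \<le> 1" using m(5) by simp
      finally show ?thesis using 1 by (simp add: v_def distrib_left)
    qed
    have K1: "real m * v - l m * (c * real m) \<le> 1 - (1 + \<beta>) * ln (real m)"
    proof -
      have "l m * (c * real m) = 2 * ((1 + \<beta>) * ln (real m))"
        using m(1) c by (simp add: l_def K_def)
      then show ?thesis using mv by simp
    qed
    let ?S = "\<lambda>B. {\<omega> \<in> space M. (\<Sum>i\<in>B. min (X i \<omega>) (\<delta> * real m)) \<ge> c * real m}"
    let ?J = "\<lambda>i. {\<omega> \<in> space M. X i \<omega> \<in> {\<delta> * real m<..}}"
    have S_le: "prob (?S B) \<le> exp 1 * real m powr (- (1 + \<beta>))" if B: "B \<in> \<B>" for B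
    proof -
      have B': "B \<subseteq> {1..}" "finite B" "card B \<le> m"
        using B A finite_subset[of B A] card_mono[OF A(2), of B] by auto
      have "prob (?S B) \<le> exp (real m * v - l m * (c * real m))"
        by (rule chernoff_truncated[OF B' lpos mgf v0])
      also have "\<dots> \<le> exp (1 - (1 + \<beta>) * ln (real m))" using K1 by simp
      also have "\<dots> = exp 1 * real m powr (- (1 + \<beta>))"
      proof -
        have "1 - (1 + \<beta>) * ln (real m) = 1 + - (1 + \<beta>) * ln (real m)" by (simp add: algebra_simps)
        moreover have "real m powr (- (1 + \<beta>)) = exp (- (1 + \<beta>) * ln (real m))"
          using m(1) by (simp add: powr_def)
        ultimately show ?thesis by (simp only: exp_add)
      qed
      finally show ?thesis .
    qed
    have meas: "X i \<in> borel_measurable M" if "i \<in> A" for i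
      by (rule measurable_X) (use A(1) that in auto)
    have Sm: "?S B \<in> events" if B: "B \<in> \<B>" for B
    proof -
      have "(\<lambda>\<omega>. \<Sum>i\<in>B. min (X i \<omega>) (\<delta> * real m)) \<in> borel_measurable M"
        using A(4) B meas by (intro borel_measurable_sum borel_measurable_min) auto
      then show ?thesis by measurable
    qed
    have Jm: "?J i \<in> events" if "i \<in> A" for i
      using meas[OF that] by measurable
    have "{\<omega> \<in> space M. \<exists>B\<in>\<B>. (\<Sum>i\<in>B. X i \<omega>) \<ge> c * real m} \<subseteq> (\<Union>i\<in>A. ?J i) \<union> (\<Union>B\<in>\<B>. ?S B)"
    proof safe
      fix \<omega> B assume w: "\<omega> \<in> space M" "B \<in> \<B>" "c * real m \<le> (\<Sum>i\<in>B. X i \<omega>)" "\<omega> \<notin> (\<Union>B\<in>\<B>. ?S B)"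
      show "\<omega> \<in> (\<Union>i\<in>A. ?J i)"
      proof (rule ccontr)
        assume "\<omega> \<notin> (\<Union>i\<in>A. ?J i)"
        then have "\<forall>i\<in>A. X i \<omega> \<le> \<delta> * real m" using w(1) by auto
        then have "(\<Sum>i\<in>B. min (X i \<omega>) (\<delta> * real m)) = (\<Sum>i\<in>B. X i \<omega>)"
          using A(4) w(2) by (intro sum.cong refl min_absorb1) blast
        with w show False by auto
      qed
    qed
    then have "prob {\<omega> \<in> space M. \<exists>B\<in>\<B>. (\<Sum>i\<in>B. X i \<omega>) \<ge> c * real m}
        \<le> prob ((\<Union>i\<in>A. ?J i) \<union> (\<Union>B\<in>\<B>. ?S B))"
      using Jm Sm A(2) fin by (intro finite_measure_mono sets.Un sets.finite_UN) auto
    also have "\<dots> \<le> prob (\<Union>i\<in>A. ?J i) + prob (\<Union>B\<in>\<B>. ?S B)"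
      using Jm Sm A(2) fin by (intro measure_Un_le sets.finite_UN) auto
    also have "prob (\<Union>i\<in>A. ?J i) \<le> (\<Sum>i\<in>A. prob (?J i))"
      using Jm A(2) by (intro finite_measure_subadditive_finite) auto
    also have "\<dots> \<le> (\<Sum>i\<in>A. D' * (\<delta> * real m) powr (- \<beta>))"
    proof (rule sum_mono)
      fix i assume "i \<in> A"
      then have "prob (?J i) = prob {\<omega> \<in> space M. X 1 \<omega> \<in> {\<delta> * real m<..}}"
        using A(1) by (intro prob_X) auto
      also have "\<dots> \<le> D' * (\<delta> * real m) powr (- \<beta>)" using tail'[OF m(4)] by simp
      finally show "prob (?J i) \<le> D' * (\<delta> * real m) powr (- \<beta>)" .
    qed
    also have "\<dots> = real (card A) * (D' * (\<delta> * real m) powr (- \<beta>))" by simp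
    also have "\<dots> \<le> real m * (D' * (\<delta> * real m) powr (- \<beta>))"
      using A(3) D' by (intro mult_right_mono) auto
    also have "\<dots> = D' * \<delta> powr (- \<beta>) * real m powr (1 - \<beta>)"
      using \<delta> m(1) by (simp add: powr_mult powr_diff powr_minus divide_inverse)
    also have "prob (\<Union>B\<in>\<B>. ?S B) \<le> (\<Sum>B\<in>\<B>. prob (?S B))"
      using Sm fin by (intro finite_measure_subadditive_finite) auto
    also have "\<dots> \<le> (\<Sum>B\<in>\<B>. exp 1 * real m powr (- (1 + \<beta>)))"
      by (rule sum_mono[OF S_le])
    also have "\<dots> = real (card \<B>) * (exp 1 * real m powr (- (1 + \<beta>)))" by simp
    also have "\<dots> \<le> real m * (exp 1 * real m powr (- (1 + \<beta>)))"
      using A(5) by (intro mult_right_mono) auto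
    also have "\<dots> = exp 1 * real m powr (1 + - (1 + \<beta>))"
      using m(1) by (simp only: powr_add) simp
    also have "\<dots> \<le> exp 1 * real m powr (1 - \<beta>)"
      using m(1) by (intro mult_left_mono powr_mono) auto
    finally show ?thesis by (simp add: C_def algebra_simps)
  qed
  show ?thesis
  proof (intro exI[of _ C] conjI)
    show "C > 0" using main by simp
    show "\<forall>\<^sub>F m in sequentially. \<forall>A \<B>. A \<subseteq> {1..} \<longrightarrow> finite A \<longrightarrow> card A \<le> m \<longrightarrow>
      \<B> \<subseteq> Pow A \<longrightarrow> card \<B> \<le> m \<longrightarrow>
      prob {\<omega> \<in> space M. \<exists>B\<in>\<B>. (\<Sum>i\<in>B. X i \<omega>) \<ge> c * real m} \<le> C * real m powr (1 - \<beta>)"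
      using conjunct2[OF main]
    proof eventually_elim
      case (elim m)
      then show ?case by (intro allI impI bound) (elim conjE, assumption)+
    qed
  qed
qed

end

section \<open>Consequences of the tail assumptions\<close>

locale heavy_tailed_walk = iid_sequence M X
  for M :: "'a measure" and X :: "nat \<Rightarrow> 'a \<Rightarrow> real" +
  fixes L :: "real \<Rightarrow> real" and \<alpha> a b :: real
  assumes \<alpha>: "\<alpha> > 1"
    and integrable_X: "integrable M (X 1)"
    and mean_X: "expectation (X 1) = 0"
    and slowly_varying_L: "slowly_varying L"
    and right_tail: "\<And>x. x > 0 \<Longrightarrow> prob {\<omega> \<in> space M. X 1 \<omega> > x} = x powr (- \<alpha>) * L x"
    and left_tail: "Limsup at_top (\<lambda>x::real. ereal (prob {\<omega> \<in> space M. X 1 \<omega> < - x}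
          / prob {\<omega> \<in> space M. X 1 \<omega> > x})) \<in> {0..<\<infinity>}"
    and ab: "0 < a" "a < b"
    and charged: "prob {\<omega> \<in> space M. X 1 \<omega> \<in> {a<..<b}} > 0"
begin

definition tail :: "real \<Rightarrow> real"
  where "tail x = prob {\<omega> \<in> space M. X 1 \<omega> > x}"

lemma tail_pos: "x > 0 \<Longrightarrow> tail x > 0"
  using right_tail[of x] slowly_varying_L by (simp add: tail_def slowly_varying_def)

lemma tail_le_1: "tail x \<le> 1"
  by (simp add: tail_def)

lemma tail_antimono: "x \<le> y \<Longrightarrow> tail y \<le> tail x"
  unfolding tail_def by (intro finite_measure_mono) auto

lemma tail_ratio_tendsto:
  assumes "t > 0"
  shows "((\<lambda>x. tail (t * x) / tail x) \<longlongrightarrow> t powr (- \<alpha>)) at_top"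
proof -
  have "((\<lambda>x. L (t * x) / L x) \<longlongrightarrow> 1) at_top"
    using slowly_varying_L assms by (simp add: slowly_varying_def)
  from tendsto_mult_left[OF this, of "t powr (- \<alpha>)"]
  have "((\<lambda>x. t powr (- \<alpha>) * (L (t * x) / L x)) \<longlongrightarrow> t powr (- \<alpha>)) at_top" by simp
  then show ?thesis
  proof (rule Lim_transform_eventually)
    show "\<forall>\<^sub>F x in at_top. t powr (- \<alpha>) * (L (t * x) / L x) = tail (t * x) / tail x"
      using eventually_gt_at_top[of 0]
    proof eventually_elim
      case (elim x)
      then show ?case
        using right_tail[of x] right_tail[of "t * x"] assms
        by (simp add: tail_def powr_mult)
    qed
  qed
qed

lemma right_tail_le:
  assumes "0 < \<beta>" "\<beta> < \<alpha>"
  shows "\<exists>C>0. \<exists>x0. \<forall>x\<ge>x0. prob {\<omega> \<in> space M. X 1 \<omega> > x} \<le> C * x powr (- \<beta>)"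
  using regularly_varying_upper[OF tail_pos tail_le_1 tail_ratio_tendsto[of 2] assms]
  unfolding tail_def by simp

lemma left_tail_le:
  assumes "0 < \<beta>" "\<beta> < \<alpha>"
  shows "\<exists>C>0. \<exists>x0. \<forall>x\<ge>x0. prob {\<omega> \<in> space M. - X 1 \<omega> > x} \<le> C * x powr (- \<beta>)"
proof -
  let ?r = "\<lambda>x. prob {\<omega> \<in> space M. X 1 \<omega> < - x} / tail x"
  have "Limsup at_top (\<lambda>x. ereal (?r x)) < \<infinity>"
    using left_tail by (simp add: tail_def)
  then obtain n :: nat where y: "Limsup at_top (\<lambda>x. ereal (?r x)) < ereal (real n)"
    using less_PInf_Ex_of_nat by auto
  define y where "y = real n"
  have "\<forall>\<^sub>F x in at_top. ereal (?r x) < ereal (real n)"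
    by (rule Limsup_lessD[OF y])
  then obtain x1 where x1: "\<And>x. x \<ge> x1 \<Longrightarrow> ?r x < y"
    by (auto simp: eventually_at_top_linorder y_def)
  obtain C x0 where C: "C > 0" "\<And>x. x \<ge> x0 \<Longrightarrow> tail x \<le> C * x powr (- \<beta>)"
    using right_tail_le[OF assms] unfolding tail_def by blast
  have "prob {\<omega> \<in> space M. - X 1 \<omega> > x} \<le> max 1 y * C * x powr (- \<beta>)" if "x \<ge> max 1 (max x0 x1)" for x
  proof -
    have pos: "tail x > 0" using that by (intro tail_pos) auto
    have "prob {\<omega> \<in> space M. - X 1 \<omega> > x} = prob {\<omega> \<in> space M. X 1 \<omega> < - x}"
      by (intro arg_cong[where f=prob]) auto
    also have "\<dots> \<le> y * tail x"
      using x1[of x] that pos by (simp add: divide_less_eq)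
    also have "\<dots> \<le> max 1 y * tail x" using pos by (intro mult_right_mono) auto
    also have "\<dots> \<le> max 1 y * (C * x powr (- \<beta>))"
      using that by (intro mult_left_mono C(2)) auto
    finally show ?thesis by (simp add: mult_ac)
  qed
  moreover have "max 1 y * C > 0" using C by simp
  ultimately show ?thesis by blast
qed

text \<open>
  The tail at d' x is asymptotically a fixed fraction, less than 1, of the tail at d x, so the
  interval between carries a fixed proportion of the tail.
\<close>
lemma jump_prob_ge:
  assumes d: "0 < d" "d < d'" and \<beta>: "\<beta> > \<alpha>"
  shows "\<exists>c>0. \<exists>x0. \<forall>x\<ge>x0. prob {\<omega> \<in> space M. X 1 \<omega> \<in> {d * x<..d' * x}} \<ge> c * x powr (- \<beta>)"
proof -
  obtain c x0 where c: "c > 0" "\<And>x. x \<ge> x0 \<Longrightarrow> c * x powr (- \<beta>) \<le> tail x"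
    using regularly_varying_lower[OF tail_pos tail_antimono tail_ratio_tendsto[of 2] _ \<beta>] \<alpha> \<beta> by auto
  define k where "k = (1 + (d' / d) powr (- \<alpha>)) / 2"
  have "(d' / d) powr (- \<alpha>) < 1 powr (- \<alpha>)"
    using d \<alpha> by (intro powr_less_mono2_neg) auto
  then have k: "(d' / d) powr (- \<alpha>) < k" "k < 1" by (simp_all add: k_def)
  have "\<forall>\<^sub>F x in at_top. tail (d' / d * x) / tail x < k"
    using d k by (intro order_tendstoD(2)[OF tail_ratio_tendsto]) auto
  then obtain x1 where x1: "\<And>x. x \<ge> x1 \<Longrightarrow> tail (d' / d * x) / tail x < k"
    by (auto simp: eventually_at_top_linorder)
  define x2 where "x2 = max 1 (max x0 x1) / d"
  have "prob {\<omega> \<in> space M. X 1 \<omega> \<in> {d * x<..d' * x}} \<ge> ((1 - k) * c * d powr (- \<beta>)) * x powr (- \<beta>)"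
    if "x \<ge> x2" for x
  proof -
    have dx: "d * x \<ge> max 1 (max x0 x1)" using that d by (simp add: x2_def field_simps)
    have x: "x > 0" using dx d(1) zero_less_mult_pos[of d x] by auto
    have pos: "tail (d * x) > 0" using dx by (intro tail_pos) auto
    have "d' / d * (d * x) = d' * x" using d by simp
    then have "tail (d' * x) < k * tail (d * x)"
      using x1[of "d * x"] dx pos by (simp add: divide_less_eq)
    moreover have "prob {\<omega> \<in> space M. X 1 \<omega> \<in> {d * x<..d' * x}} = tail (d * x) - tail (d' * x)"
    proof -
      have *: "{\<omega> \<in> space M. X 1 \<omega> \<in> {d * x<..d' * x}}
          = {\<omega> \<in> space M. X 1 \<omega> > d * x} - {\<omega> \<in> space M. X 1 \<omega> > d' * x}" by auto
      have "d * x \<le> d' * x" using d x by simp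
      then show ?thesis unfolding tail_def *
        by (intro finite_measure_Diff) auto
    qed
    moreover have "(1 - k) * tail (d * x) \<ge> (1 - k) * (c * (d * x) powr (- \<beta>))"
      using k dx by (intro mult_left_mono c(2)) auto
    ultimately show ?thesis using d x by (simp add: powr_mult algebra_simps)
  qed
  moreover have "(1 - k) * c * d powr (- \<beta>) > 0" using k c d by simp
  ultimately show ?thesis by blast
qed

lemma maximal_inequality:
  assumes "1 < \<beta>" "\<beta> < \<alpha>" "c > 0"
  shows "\<exists>C>0. \<forall>\<^sub>F m in sequentially. \<forall>A \<B>. A \<subseteq> {1..} \<longrightarrow> finite A \<longrightarrow> card A \<le> m \<longrightarrow>
    \<B> \<subseteq> Pow A \<longrightarrow> card \<B> \<le> m \<longrightarrow>
    prob {\<omega> \<in> space M. \<exists>B\<in>\<B>. (\<Sum>i\<in>B. X i \<omega>) \<ge> c * real m} \<le> C * real m powr (1 - \<beta>)"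
proof -
  obtain D x0 where "\<And>x. x \<ge> x0 \<Longrightarrow> prob {\<omega> \<in> space M. X 1 \<omega> > x} \<le> D * x powr (- \<beta>)"
    using right_tail_le[of \<beta>] assms by auto
  then show ?thesis
    by (rule maximal_inequality_heavy_tail[OF integrable_X mean_X _ assms(1,3)])
qed

lemma maximal_inequality_uminus:
  assumes "1 < \<beta>" "\<beta> < \<alpha>" "c > 0"
  shows "\<exists>C>0. \<forall>\<^sub>F m in sequentially. \<forall>A \<B>. A \<subseteq> {1..} \<longrightarrow> finite A \<longrightarrow> card A \<le> m \<longrightarrow>
    \<B> \<subseteq> Pow A \<longrightarrow> card \<B> \<le> m \<longrightarrow>
    prob {\<omega> \<in> space M. \<exists>B\<in>\<B>. (\<Sum>i\<in>B. - X i \<omega>) \<ge> c * real m} \<le> C * real m powr (1 - \<beta>)"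
proof -
  interpret neg: iid_sequence M "\<lambda>i \<omega>. - X i \<omega>" by (rule iid_sequence_uminus)
  obtain D x0 where D: "\<And>x. x \<ge> x0 \<Longrightarrow> prob {\<omega> \<in> space M. - X 1 \<omega> > x} \<le> D * x powr (- \<beta>)"
    using left_tail_le[of \<beta>] assms by auto
  have "integrable M (\<lambda>\<omega>. - X 1 \<omega>)" "expectation (\<lambda>\<omega>. - X 1 \<omega>) = 0"
    using integrable_X mean_X by simp_all
  then show ?thesis
    by (rule neg.maximal_inequality_heavy_tail[OF _ _ D assms(1,3)])
qed

text \<open>
  A weak law of large numbers that is uniform over m partial sums. It comes from the maximal inequality
  applied to X and to -X; the condition on the left tail makes the latter possible.
\<close>
lemma fluctuations_small:
  assumes c: "c > 0"
  shows "\<forall>\<^sub>F m in sequentially. \<forall>A \<B>. A \<subseteq> {1..} \<longrightarrow> finite A \<longrightarrow> card A \<le> m \<longrightarrow>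
    \<B> \<subseteq> Pow A \<longrightarrow> card \<B> \<le> m \<longrightarrow>
    prob {\<omega> \<in> space M. \<forall>B\<in>\<B>. \<bar>\<Sum>i\<in>B. X i \<omega>\<bar> \<le> c * real m} \<ge> 1 / 2"
proof -
  obtain \<beta> where \<beta>: "1 < \<beta>" "\<beta> < \<alpha>" using \<alpha> dense by blast
  obtain C1 where C1: "C1 > 0" "\<forall>\<^sub>F m in sequentially. \<forall>A \<B>. A \<subseteq> {1..} \<longrightarrow> finite A \<longrightarrow> card A \<le> m \<longrightarrow>
    \<B> \<subseteq> Pow A \<longrightarrow> card \<B> \<le> m \<longrightarrow>
    prob {\<omega> \<in> space M. \<exists>B\<in>\<B>. (\<Sum>i\<in>B. X i \<omega>) \<ge> c * real m} \<le> C1 * real m powr (1 - \<beta>)"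
    using maximal_inequality[OF \<beta> c] by blast
  obtain C2 where C2: "C2 > 0" "\<forall>\<^sub>F m in sequentially. \<forall>A \<B>. A \<subseteq> {1..} \<longrightarrow> finite A \<longrightarrow> card A \<le> m \<longrightarrow>
    \<B> \<subseteq> Pow A \<longrightarrow> card \<B> \<le> m \<longrightarrow>
    prob {\<omega> \<in> space M. \<exists>B\<in>\<B>. (\<Sum>i\<in>B. - X i \<omega>) \<ge> c * real m} \<le> C2 * real m powr (1 - \<beta>)"
    using maximal_inequality_uminus[OF \<beta> c] by blast
  define \<gamma> where "\<gamma> = \<beta> - 1"
  have g: "\<gamma> > 0" "1 - \<beta> = - \<gamma>" using \<beta> by (auto simp: \<gamma>_def)
  have "(\<lambda>m. (C1 + C2) * real m powr (- \<gamma>)) \<longlonglongrightarrow> 0"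
    using g by real_asymp
  then have "\<forall>\<^sub>F m in sequentially. (C1 + C2) * real m powr (1 - \<beta>) < 1 / 2"
    unfolding g(2) by (intro order_tendstoD(2)) auto
  with C1(2) C2(2) show ?thesis
  proof eventually_elim
    case (elim m)
    show ?case
    proof (intro allI impI)
      fix A :: "nat set" and \<B> assume A: "A \<subseteq> {1..}" "finite A" "card A \<le> m" "\<B> \<subseteq> Pow A" "card \<B> \<le> (m :: nat)"
      let ?U = "{\<omega> \<in> space M. \<exists>B\<in>\<B>. (\<Sum>i\<in>B. X i \<omega>) \<ge> c * real m}"
      let ?V = "{\<omega> \<in> space M. \<exists>B\<in>\<B>. (\<Sum>i\<in>B. - X i \<omega>) \<ge> c * real m}"
      let ?W = "{\<omega> \<in> space M. \<forall>B\<in>\<B>. \<bar>\<Sum>i\<in>B. X i \<omega>\<bar> \<le> c * real m}"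
      have fin: "finite \<B>" using A(2,4) by (meson finite_Pow_iff finite_subset)
      have B: "B \<subseteq> {1..}" if "B \<in> \<B>" for B using that A(1,4) by auto
      have U: "?U \<in> events"
        using fin B sets_sum[of _ "{c * real m..}"] by (intro sets.sets_Collect_finite_Ex) auto
      have V: "?V \<in> events"
        using fin B sets_sum[of _ "{..- c * real m}"]
        by (intro sets.sets_Collect_finite_Ex) (auto simp: sum_negf le_minus_iff)
      have W: "?W \<in> events"
        using fin B sets_sum[of _ "{- c * real m..c * real m}"]
        by (intro sets.sets_Collect_finite_All) (auto simp: abs_le_iff conj_commute minus_le_iff)
      have "space M - ?W \<subseteq> ?U \<union> ?V"
        by (auto simp: sum_negf abs_le_iff not_le intro: less_imp_le)
      then have "prob (space M - ?W) \<le> prob (?U \<union> ?V)"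
        using U V by (intro finite_measure_mono) auto
      also have "\<dots> \<le> prob ?U + prob ?V" by (rule measure_Un_le[OF U V])
      also have "\<dots> \<le> (C1 + C2) * real m powr (1 - \<beta>)"
        using elim(1)[rule_format, OF A] elim(2)[rule_format, OF A] by (simp add: distrib_right)
      also have "\<dots> < 1 / 2" by (rule elim(3))
      finally show "prob ?W \<ge> 1 / 2" using prob_compl[OF W] by simp
    qed
  qed
qed

end

section \<open>Products along a geometric sequence of times\<close>

definition geom_time :: "real \<Rightarrow> nat \<Rightarrow> nat"
  where "geom_time q j = nat \<lceil>q ^ j\<rceil>"

lemma geom_time_bounds:
  assumes "q > 1"
  shows "q ^ j \<le> real (geom_time q j)" "real (geom_time q j) \<le> q ^ j + 1"
    "real (geom_time q j) \<le> 2 * q ^ j" "geom_time q j \<ge> 1"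
proof -
  have q: "q ^ j \<ge> 1" using assms by simp
  then have e: "real (geom_time q j) = of_int \<lceil>q ^ j\<rceil>"
    by (simp add: geom_time_def)
  show 1: "q ^ j \<le> real (geom_time q j)" "real (geom_time q j) \<le> q ^ j + 1"
    unfolding e by linarith+
  show "real (geom_time q j) \<le> 2 * q ^ j" using 1 q by linarith
  have "real (geom_time q j) \<ge> 1" using 1 q by linarith
  then show "geom_time q j \<ge> 1" by simp
qed

lemma geom_time_mono: "q > 1 \<Longrightarrow> i \<le> j \<Longrightarrow> geom_time q i \<le> geom_time q j"
  unfolding geom_time_def by (intro nat_mono ceiling_mono power_increasing) auto

lemma geom_time_ratio:
  assumes q: "q > 1"
  shows "(\<lambda>j. real (geom_time q (Suc j)) / real (geom_time q j)) \<longlonglongrightarrow> q"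
proof -
  let ?r = "\<lambda>j. real (geom_time q j) / q ^ j"
  have r: "?r \<longlonglongrightarrow> 1"
  proof (rule tendsto_sandwich[of "\<lambda>_. 1" _ _ "\<lambda>j. 1 + (1 / q) ^ j"])
    show "\<forall>\<^sub>F j in sequentially. 1 \<le> ?r j"
      using geom_time_bounds(1)[OF q] q by (simp add: le_divide_eq)
    have "?r j \<le> (q ^ j + 1) / q ^ j" for j
      using geom_time_bounds(2)[OF q] q by (intro divide_right_mono) auto
    moreover have "(q ^ j + 1) / q ^ j = 1 + (1 / q) ^ j" for j
      using q by (simp add: add_divide_distrib power_divide)
    ultimately show "\<forall>\<^sub>F j in sequentially. ?r j \<le> 1 + (1 / q) ^ j"
      by (simp only: eventually_True)
    have "(\<lambda>j. 1 + (1 / q) ^ j) \<longlonglongrightarrow> 1 + 0"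
      using q by (intro tendsto_intros LIMSEQ_realpow_zero) auto
    then show "(\<lambda>j. 1 + (1 / q) ^ j) \<longlonglongrightarrow> 1" by simp
  qed auto
  have "(\<lambda>j. q * (?r (Suc j) / ?r j)) \<longlonglongrightarrow> q * (1 / 1)"
    by (intro tendsto_intros r LIMSEQ_Suc[OF r]) auto
  moreover have "q * (?r (Suc j) / ?r j) = real (geom_time q (Suc j)) / real (geom_time q j)" for j
    using q by simp
  ultimately show ?thesis by (simp only: div_by_1 mult_1_right)
qed

lemma geom_time_at_top:
  assumes "q > 1"
  shows "filterlim (geom_time q) sequentially sequentially"
proof -
  have "filterlim (\<lambda>j. q ^ j) at_top sequentially"
    using assms by real_asymp
  then have "filterlim (\<lambda>j. real (geom_time q j)) at_top sequentially"
    by (rule filterlim_at_top_mono)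
       (use geom_time_bounds(1)[OF assms] in auto)
  then show ?thesis by (simp add: filterlim_sequentially_iff_filterlim_real comp_def)
qed

text \<open>
  Iterating the recursion gives the factors C q^(-gamma j), and the exponents gamma j ln q add up to
  gamma ln q J^2 / 2; the constant C only contributes a term linear in J.
\<close>
lemma ln_product_ge:
  fixes u :: "nat \<Rightarrow> real"
  assumes q: "q > 1" and C: "C > 0" and u: "\<And>j. j \<ge> j0 \<Longrightarrow> u j > 0"
    and step: "\<And>j. j \<ge> j0 \<Longrightarrow> u (Suc j) \<ge> u j * (C * (q ^ j) powr (- \<gamma>))"
  shows "\<exists>A B. \<forall>J\<ge>j0. ln (u J) \<ge> A + B * real J + (- \<gamma> * ln q / 2) * (real J)\<^sup>2"
proof -
  \<comment> \<open>F solves the recursion with equality: F (J + 1) - F J = ln C - gamma j ln q at j = J.\<close>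
  define F where "F J = (ln C + \<gamma> * ln q / 2) * real J + (- \<gamma> * ln q / 2) * (real J)\<^sup>2" for J
  have "ln (u J) \<ge> ln (u j0) - F j0 + F J" if "J \<ge> j0" for J
    using that
  proof (induction J rule: dec_induct)
    case (step J)
    have "u J * (C * (q ^ J) powr (- \<gamma>)) > 0" using u[of J] step C q by simp
    then have "ln (u (Suc J)) \<ge> ln (u J * (C * (q ^ J) powr (- \<gamma>)))"
      using assms(4)[of J] step by simp
    also have "ln (u J * (C * (q ^ J) powr (- \<gamma>))) = ln (u J) + (ln C - \<gamma> * ln q * real J)"
      using u[of J] step C q by (simp add: ln_mult ln_realpow)
    also have "ln C - \<gamma> * ln q * real J = F (Suc J) - F J"
      by (simp add: F_def power2_eq_square field_simps)
    finally show ?case using step.IH by simp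
  qed simp
  then show ?thesis unfolding F_def by (metis add.assoc)
qed

lemma ln_product_le:
  fixes u :: "nat \<Rightarrow> real"
  assumes q: "q > 1" and C: "C > 0" and u: "\<And>j. j \<ge> j0 \<Longrightarrow> u j > 0"
    and step: "\<And>j. j \<ge> j0 \<Longrightarrow> u (Suc j) \<le> u j * (C * (q ^ j) powr (- \<gamma>))"
  shows "\<exists>A B. \<forall>J\<ge>j0. ln (u J) \<le> A + B * real J + (- \<gamma> * ln q / 2) * (real J)\<^sup>2"
proof -
  have "\<exists>A B. \<forall>J\<ge>j0. ln (1 / u J) \<ge> A + B * real J + (- (- \<gamma>) * ln q / 2) * (real J)\<^sup>2"
  proof (rule ln_product_ge[OF q, where C="1 / C"])
    fix j assume j: "j \<ge> j0"
    have "1 / (u j * (C * (q ^ j) powr (- \<gamma>))) \<le> 1 / u (Suc j)"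
      using u[of j] u[of "Suc j"] step[OF j] j C q by (intro divide_left_mono) auto
    then show "1 / u (Suc j) \<ge> 1 / u j * (1 / C * (q ^ j) powr (- (- \<gamma>)))"
      by (simp add: powr_minus_divide)
  qed (use C u in auto)
  then obtain A B where AB: "\<And>J. J \<ge> j0 \<Longrightarrow>
      ln (1 / u J) \<ge> A + B * real J + (- (- \<gamma>) * ln q / 2) * (real J)\<^sup>2"
    by blast
  have "ln (u J) \<le> - A + - B * real J + (- \<gamma> * ln q / 2) * (real J)\<^sup>2" if "J \<ge> j0" for J
    using AB[OF that] u[OF that] by (simp add: ln_div)
  then show ?thesis by blast
qed

text \<open>
  With J = log n / log q up to rounding, the quadratic term gamma ln q J^2 / 2 becomes
  gamma (log n)^2 / (2 log q).
\<close>
lemma quadratic_over_ln_square: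
  fixes J :: "nat \<Rightarrow> nat"
  assumes q: "q > 1" and J: "\<And>n. n \<ge> 1 \<Longrightarrow> \<bar>real (J n) - ln (real n) / ln q\<bar> \<le> 1"
  shows "(\<lambda>n. 1 / (ln (real n))\<^sup>2 * (A + B * real (J n) + (- \<gamma> * ln q / 2) * (real (J n))\<^sup>2))
    \<longlonglongrightarrow> - (\<gamma> / (2 * ln q))"
proof -
  have lnq: "ln q > 0" using q by simp
  have inv: "(\<lambda>n. 1 / ln (real n)) \<longlonglongrightarrow> 0" by real_asymp
  have "(\<lambda>n. real (J n) / ln (real n) - 1 / ln q) \<longlonglongrightarrow> 0"
  proof (rule Lim_null_comparison[OF _ inv])
    show "\<forall>\<^sub>F n in sequentially. norm (real (J n) / ln (real n) - 1 / ln q) \<le> 1 / ln (real n)"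
      using eventually_ge_at_top[of 2]
    proof eventually_elim
      case (elim n)
      then have l: "ln (real n) > 0" by simp
      have "real (J n) / ln (real n) - 1 / ln q = (real (J n) - ln (real n) / ln q) / ln (real n)"
        using l by (simp add: diff_divide_distrib)
      then show ?case using J[of n] elim l by (simp add: abs_divide divide_right_mono)
    qed
  qed
  then have r: "(\<lambda>n. real (J n) / ln (real n)) \<longlonglongrightarrow> 1 / ln q" by (rule LIM_zero_cancel)
  have "(\<lambda>n. A * (1 / ln (real n))\<^sup>2 + B * (real (J n) / ln (real n)) * (1 / ln (real n))
      + (- \<gamma> * ln q / 2) * (real (J n) / ln (real n))\<^sup>2)
    \<longlonglongrightarrow> A * 0\<^sup>2 + B * (1 / ln q) * 0 + (- \<gamma> * ln q / 2) * (1 / ln q)\<^sup>2"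
    by (intro tendsto_intros inv r)
  moreover have "A * 0\<^sup>2 + B * (1 / ln q) * 0 + (- \<gamma> * ln q / 2) * (1 / ln q)\<^sup>2 = - (\<gamma> / (2 * ln q))"
    using lnq by (simp add: power2_eq_square)
  moreover have "A * (1 / ln (real n))\<^sup>2 + B * (real (J n) / ln (real n)) * (1 / ln (real n))
      + (- \<gamma> * ln q / 2) * (real (J n) / ln (real n))\<^sup>2
    = 1 / (ln (real n))\<^sup>2 * (A + B * real (J n) + (- \<gamma> * ln q / 2) * (real (J n))\<^sup>2)" for n
    by (simp add: power_divide power2_eq_square algebra_simps add_divide_distrib)
  ultimately show ?thesis by (simp only:)
qed

lemma geom_time_floor_le:
  assumes "q > 1" "n \<ge> 1"
  shows "geom_time q (nat \<lfloor>ln (real n) / ln q\<rfloor>) \<le> n"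
proof -
  let ?J = "nat \<lfloor>ln (real n) / ln q\<rfloor>"
  have lnq: "ln q > 0" using assms by simp
  have "real ?J \<le> ln (real n) / ln q" using assms lnq by simp
  then have "real ?J * ln q \<le> ln (real n)" using lnq by (simp add: le_divide_eq)
  then have "ln (q ^ ?J) \<le> ln (real n)" using assms by (simp add: ln_realpow)
  then have "q ^ ?J \<le> real n" using assms by (subst (asm) ln_le_cancel_iff) auto
  then have "\<lceil>q ^ ?J\<rceil> \<le> int n" by (simp add: ceiling_le_iff)
  then show ?thesis unfolding geom_time_def nat_le_iff .
qed

lemma geom_time_ceiling_ge:
  assumes "q > 1" "n \<ge> 1"
  shows "n \<le> geom_time q (nat \<lceil>ln (real n) / ln q\<rceil>)"
proof -
  let ?J = "nat \<lceil>ln (real n) / ln q\<rceil>"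
  have lnq: "ln q > 0" using assms by simp
  have "real ?J \<ge> ln (real n) / ln q" by linarith
  then have "real ?J * ln q \<ge> ln (real n)" using lnq by (simp add: divide_le_eq)
  then have "ln (q ^ ?J) \<ge> ln (real n)" using assms by (simp add: ln_realpow)
  then have "real n \<le> q ^ ?J" using assms by (subst (asm) ln_le_cancel_iff) auto
  also have "\<dots> \<le> real (geom_time q ?J)" by (rule geom_time_bounds(1)[OF assms(1)])
  finally show ?thesis by simp
qed

lemma filterlim_ln_index:
  assumes "q > 1" and J: "\<And>n. n \<ge> 1 \<Longrightarrow> \<bar>real (J n) - ln (real n) / ln q\<bar> \<le> 1"
  shows "\<forall>\<^sub>F n in sequentially. J n \<ge> (j0 :: nat)"
proof -
  have lnq: "ln q > 0" using assms by simp
  have "filterlim (\<lambda>n::nat. ln (real n) / ln q - 1) at_top sequentially"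
    using lnq by real_asymp
  then have "\<forall>\<^sub>F n in sequentially. ln (real n) / ln q - 1 \<ge> real j0"
    unfolding filterlim_at_top by blast
  with eventually_ge_at_top[of 1] show ?thesis
  proof eventually_elim
    case (elim n)
    then show ?case using J[of n] by linarith
  qed
qed

section \<open>Upper bound\<close>

context heavy_tailed_walk
begin

text \<open>
  The event of the theorem, with the averages multiplied out so that the conditions are on sums.
\<close>
definition in_cone :: "nat \<Rightarrow> (nat \<Rightarrow> real) \<Rightarrow> bool"
  where "in_cone n f \<longleftrightarrow> (\<forall>k\<in>{1..n}. (\<Sum>i=1..k. f i) \<in> {a * real k..b * real k})"

definition persistence :: "nat \<Rightarrow> real"
  where "persistence n = prob {\<omega> \<in> space M. in_cone n (\<lambda>i. X i \<omega>)}"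

lemma in_cone_restrict: "in_cone n (restrict f {1..n}) = in_cone n f"
proof -
  have "(\<Sum>i=1..k. restrict f {1..n} i) = (\<Sum>i=1..k. f i)" if "k \<in> {1..n}" for k
    using that by (intro sum.cong) auto
  then show ?thesis by (auto simp: in_cone_def)
qed

lemma sets_PiM_in_cone:
  "{f \<in> space (PiM {1..n} (\<lambda>_. borel)). in_cone n f} \<in> sets (PiM {1..n} (\<lambda>_. borel))"
  unfolding in_cone_def
  by (intro sets.sets_Collect_finite_All sets_PiM_sum) auto

lemma sets_in_cone: "{\<omega> \<in> space M. in_cone n (\<lambda>i. X i \<omega>)} \<in> events"
  unfolding in_cone_def
  by (intro sets.sets_Collect_finite_All sets_sum) auto

lemma persistence_antimono: "m \<le> n \<Longrightarrow> persistence n \<le> persistence m"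
  unfolding persistence_def
  by (intro finite_measure_mono sets_in_cone) (auto simp: in_cone_def)

lemma persistence_pos: "persistence n > 0"
proof (cases "n = 0")
  case True
  then show ?thesis by (simp add: persistence_def in_cone_def prob_space)
next
  case False
  let ?E = "\<Inter>i\<in>{1..n}. X i -` {a<..<b} \<inter> space M"
  have "prob ?E = (\<Prod>i\<in>{1..n}. prob (X i -` {a<..<b} \<inter> space M))"
    using False by (intro indep_varsD[OF indep]) auto
  also have "\<dots> = (\<Prod>i\<in>{1..n}. prob {\<omega> \<in> space M. X 1 \<omega> \<in> {a<..<b}})"
  proof (rule prod.cong[OF refl])
    fix i assume "i \<in> {1..n}"
    then have "prob {\<omega> \<in> space M. X i \<omega> \<in> {a<..<b}} = prob {\<omega> \<in> space M. X 1 \<omega> \<in> {a<..<b}}"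
      by (intro prob_X) auto
    then show "prob (X i -` {a<..<b} \<inter> space M) = prob {\<omega> \<in> space M. X 1 \<omega> \<in> {a<..<b}}"
      by (simp add: vimage_def Int_def conj_commute)
  qed
  also have "\<dots> > 0" using charged by (intro prod_pos) auto
  finally have "0 < prob ?E" .
  also have "prob ?E \<le> persistence n"
    unfolding persistence_def
  proof (intro finite_measure_mono sets_in_cone subsetI)
    fix \<omega> assume w: "\<omega> \<in> ?E"
    have "(\<Sum>i=1..k. X i \<omega>) \<in> {a * real k..b * real k}" if "k \<in> {1..n}" for k
    proof -
      have "a \<le> X i \<omega> \<and> X i \<omega> \<le> b" if "i \<in> {1..k}" for i
        using w that \<open>k \<in> {1..n}\<close> by (force intro: less_imp_le)
      then have "(\<Sum>i=1..k. a) \<le> (\<Sum>i=1..k. X i \<omega>)" "(\<Sum>i=1..k. X i \<omega>) \<le> (\<Sum>i=1..k. b)"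
        by (intro sum_mono; simp)+
      then show ?thesis by (simp add: mult.commute)
    qed
    then show "\<omega> \<in> {\<omega> \<in> space M. in_cone n (\<lambda>i. X i \<omega>)}"
      using w False by (auto simp: in_cone_def)
  qed
  finally show ?thesis .
qed

lemma sum_split_block:
  fixes f :: "nat \<Rightarrow> real"
  assumes "t \<le> k"
  shows "(\<Sum>i=1..k. f i) = (\<Sum>i=1..t. f i) + (\<Sum>i\<in>{t<..k}. f i)"
proof -
  have "{1..k} = {1..t} \<union> {t<..k}" using assms by auto
  then show ?thesis by (simp add: sum.union_disjoint ivl_disj_int)
qed

text \<open>
  If q > b/a, a path that stays in the cone has S(t) \<le> b t and S(q t) \<ge> a q t > b t, so between t and
  q t it grows by a positive multiple of t. The increment is independent of the past, and by the
  maximal inequality a growth of this size costs t^(1-beta).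
\<close>
lemma persistence_step_upper:
  assumes q: "q > b / a" and \<beta>: "1 < \<beta>" "\<beta> < \<alpha>"
  shows "\<exists>C>0. \<exists>j0. \<forall>j\<ge>j0. persistence (geom_time q (Suc j))
    \<le> persistence (geom_time q j) * (C * (q ^ j) powr (- (\<beta> - 1)))"
proof -
  have q1: "q > 1" using q ab by (smt (verit) less_divide_eq_1_pos)
  define c where "c = (a - b / q) / 2"
  have c: "c > 0" using q ab q1 by (simp add: c_def field_simps)
  let ?t = "geom_time q"
  obtain C where C: "C > 0" and max: "\<forall>\<^sub>F m in sequentially. \<forall>A \<B>. A \<subseteq> {1..} \<longrightarrow> finite A \<longrightarrow>
    card A \<le> m \<longrightarrow> \<B> \<subseteq> Pow A \<longrightarrow> card \<B> \<le> m \<longrightarrow>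
    prob {\<omega> \<in> space M. \<exists>B\<in>\<B>. (\<Sum>i\<in>B. X i \<omega>) \<ge> c * real m} \<le> C * real m powr (1 - \<beta>)"
    using maximal_inequality[OF \<beta> c] by blast
  have "filterlim (\<lambda>j. ?t (Suc j)) sequentially sequentially"
    using geom_time_at_top[OF q1] by (rule filterlim_compose[OF _ filterlim_Suc])
  from eventually_compose_filterlim[OF max this]
  have ev1: "\<forall>\<^sub>F j in sequentially. \<forall>A \<B>. A \<subseteq> {1..} \<longrightarrow> finite A \<longrightarrow>
    card A \<le> ?t (Suc j) \<longrightarrow> \<B> \<subseteq> Pow A \<longrightarrow> card \<B> \<le> ?t (Suc j) \<longrightarrow>
    prob {\<omega> \<in> space M. \<exists>B\<in>\<B>. (\<Sum>i\<in>B. X i \<omega>) \<ge> c * real (?t (Suc j))}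
      \<le> C * real (?t (Suc j)) powr (1 - \<beta>)" .
  have "(\<lambda>j. b / (real (?t (Suc j)) / real (?t j))) \<longlonglongrightarrow> b / q"
    using q1 by (intro tendsto_intros geom_time_ratio) auto
  moreover have "2 * c = a - b / q" by (simp add: c_def)
  then have "b / q < a - c" using c by linarith
  ultimately have ev2: "\<forall>\<^sub>F j in sequentially. b / (real (?t (Suc j)) / real (?t j)) < a - c"
    by (rule order_tendstoD(2))
  have "\<forall>\<^sub>F j in sequentially. persistence (?t (Suc j))
      \<le> persistence (?t j) * (C * (q ^ j) powr (- (\<beta> - 1)))"
    using ev1 ev2
  proof eventually_elim
    case (elim j)
    define t where "t = ?t j"
    define t' where "t' = ?t (Suc j)"
    have tt: "t \<ge> 1" "t \<le> t'" "t' \<ge> 1"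
      unfolding t_def t'_def using geom_time_bounds(4)[OF q1] geom_time_mono[OF q1] by auto
    have inc: "a * real t' - b * real t \<ge> c * real t'"
    proof -
      have "b * real t / real t' < a - c" using elim(2) by (simp add: t_def t'_def)
      then have "b * real t < (a - c) * real t'" using tt by (simp add: divide_less_eq)
      then show ?thesis by (simp add: algebra_simps)
    qed
    let ?A = "{t<..t'}"
    let ?Q = "\<lambda>f. (\<Sum>i\<in>?A. f i) \<in> {c * real t'..}"
    have "persistence t' \<le> prob {\<omega> \<in> space M. in_cone t (\<lambda>i. X i \<omega>) \<and> ?Q (\<lambda>i. X i \<omega>)}"
      unfolding persistence_def
    proof (intro finite_measure_mono subsetI)
      fix \<omega> assume w: "\<omega> \<in> {\<omega> \<in> space M. in_cone t' (\<lambda>i. X i \<omega>)}"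
      then have "(\<Sum>i=1..t'. X i \<omega>) \<ge> a * real t'" "(\<Sum>i=1..t. X i \<omega>) \<le> b * real t"
        using tt by (auto simp: in_cone_def)
      then have "?Q (\<lambda>i. X i \<omega>)"
        using sum_split_block[OF tt(2), of "\<lambda>i. X i \<omega>"] inc by simp
      with w tt show "\<omega> \<in> {\<omega> \<in> space M. in_cone t (\<lambda>i. X i \<omega>) \<and> ?Q (\<lambda>i. X i \<omega>)}"
        by (auto simp: in_cone_def)
    next
      show "{\<omega> \<in> space M. in_cone t (\<lambda>i. X i \<omega>) \<and> ?Q (\<lambda>i. X i \<omega>)} \<in> events"
        by (intro sets.sets_Collect_conj sets_in_cone sets_sum) auto
    qed
    also have "\<dots> = persistence t * prob {\<omega> \<in> space M. ?Q (\<lambda>i. X i \<omega>)}"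
      unfolding persistence_def
    proof (rule prob_conj_disjoint_blocks[OF _ _ _ sets_PiM_in_cone in_cone_restrict])
      show "{f \<in> space (PiM ?A (\<lambda>_. borel)). ?Q f} \<in> sets (PiM ?A (\<lambda>_. borel))"
        by (rule sets_PiM_sum) auto
    qed auto
    also have "prob {\<omega> \<in> space M. ?Q (\<lambda>i. X i \<omega>)} \<le> C * real t' powr (1 - \<beta>)"
    proof -
      have "?A \<subseteq> {1..}" using tt by auto
      then show ?thesis
        using elim(1)[folded t'_def, rule_format, of ?A "{?A}"] tt by simp
    qed
    also have "real t' powr (1 - \<beta>) \<le> (q ^ j) powr (1 - \<beta>)"
    proof (rule powr_mono2')
      have "q ^ j \<le> real t" using geom_time_bounds(1)[OF q1] by (simp add: t_def)
      then show "q ^ j \<le> real t'" using tt by linarith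
    qed (use \<beta> q1 in auto)
    finally show ?case
      using C by (simp add: t_def t'_def persistence_def mult_left_mono)
  qed
  with C show ?thesis by (auto simp: eventually_sequentially)
qed

lemma log_persistence_upper:
  assumes q: "q > b / a" and \<beta>: "1 < \<beta>" "\<beta> < \<alpha>" and y: "- ((\<beta> - 1) / (2 * ln q)) < y"
  shows "\<forall>\<^sub>F n in sequentially. 1 / (ln (real n))\<^sup>2 * ln (persistence n) < y"
proof -
  have q1: "q > 1" using q ab by (smt (verit) less_divide_eq_1_pos)
  obtain C j0 where C: "C > 0" "\<And>j. j \<ge> j0 \<Longrightarrow> persistence (geom_time q (Suc j))
      \<le> persistence (geom_time q j) * (C * (q ^ j) powr (- (\<beta> - 1)))"
    using persistence_step_upper[OF q \<beta>] by blast
  obtain A B where AB: "\<And>J. J \<ge> j0 \<Longrightarrow> ln (persistence (geom_time q J))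
      \<le> A + B * real J + (- (\<beta> - 1) * ln q / 2) * (real J)\<^sup>2"
    using ln_product_le[OF q1 C(1) persistence_pos C(2)] by blast
  define J where "J n = nat \<lfloor>ln (real n) / ln q\<rfloor>" for n :: nat
  have J: "\<bar>real (J n) - ln (real n) / ln q\<bar> \<le> 1" if "n \<ge> 1" for n
  proof -
    have "ln (real n) / ln q \<ge> 0" using q1 that by simp
    then show ?thesis unfolding J_def by linarith
  qed
  have "\<forall>\<^sub>F n in sequentially.
      1 / (ln (real n))\<^sup>2 * (A + B * real (J n) + (- (\<beta> - 1) * ln q / 2) * (real (J n))\<^sup>2) < y"
    using quadratic_over_ln_square[OF q1 J] y by (rule order_tendstoD(2))
  moreover have "\<forall>\<^sub>F n in sequentially. J n \<ge> j0" by (rule filterlim_ln_index[OF q1 J])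
  ultimately show ?thesis
    using eventually_ge_at_top[of 1]
  proof eventually_elim
    case (elim n)
    have "persistence n \<le> persistence (geom_time q (J n))"
      unfolding J_def by (intro persistence_antimono geom_time_floor_le q1 elim)
    then have "ln (persistence n) \<le> ln (persistence (geom_time q (J n)))"
      using persistence_pos by simp
    also have "\<dots> \<le> A + B * real (J n) + (- (\<beta> - 1) * ln q / 2) * (real (J n))\<^sup>2"
      by (rule AB[OF elim(2)])
    finally have "1 / (ln (real n))\<^sup>2 * ln (persistence n) \<le>
      1 / (ln (real n))\<^sup>2 * (A + B * real (J n) + (- (\<beta> - 1) * ln q / 2) * (real (J n))\<^sup>2)"
      by (intro mult_left_mono) auto
    with elim(1) show ?case by simp
  qed
qed

end

section \<open>Lower bound\<close>

text \<open>
  The strategy of the lower bound in a block from t to t': S moves by a single jump, at time i, and is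
  otherwise nearly constant. The partial sums are given by a family of index sets in order to fit the
  maximal inequality.
\<close>
definition jump_at :: "nat \<Rightarrow> nat \<Rightarrow> real \<Rightarrow> real \<Rightarrow> real \<Rightarrow> nat \<Rightarrow> (nat \<Rightarrow> real) \<Rightarrow> bool"
  where "jump_at t t' D D' e i f \<longleftrightarrow> f i \<in> {D<..D'} \<and>
    (\<forall>B\<in>(\<lambda>k. {t<..k} - {i}) ` {t<..t'}. \<bar>\<Sum>l\<in>B. f l\<bar> \<le> e)"

text \<open>
  Every term other than the jump is a difference of two small partial sums, hence too small to be a
  jump itself. Therefore the events for different jump times are disjoint and their probabilities add
  up, which gains the factor t that turns t^(-beta) into t^(1-beta).
\<close>
lemma jump_at_unique:
  assumes "jump_at t t' D D' e i f" "jump_at t t' D D' e i' f"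
    and i': "i' \<in> {t<..t'}" and e: "e \<ge> 0" "2 * e \<le> D"
  shows "i = i'"
proof (rule ccontr)
  assume ne: "i \<noteq> i'"
  have small: "\<bar>\<Sum>l\<in>{t<..k} - {i}. f l\<bar> \<le> e" if "k \<in> {t<..t'}" for k
    using assms(1) that by (auto simp: jump_at_def)
  have 1: "\<bar>\<Sum>l\<in>{t<..i'} - {i}. f l\<bar> \<le> e" by (rule small[OF i'])
  have 2: "\<bar>\<Sum>l\<in>{t<..i' - 1} - {i}. f l\<bar> \<le> e"
  proof (cases "i' - 1 > t")
    case True
    then show ?thesis using i' by (intro small) auto
  next
    case False
    then have "{t<..i' - 1} - {i} = {}" by auto
    then show ?thesis using e by (simp only: sum.empty abs_zero)
  qed
  have "{t<..i'} - {i} = insert i' ({t<..i' - 1} - {i})"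
    using i' ne by auto
  moreover have "i' \<notin> {t<..i' - 1} - {i}" using i' by auto
  ultimately have "(\<Sum>l\<in>{t<..i'} - {i}. f l) = f i' + (\<Sum>l\<in>{t<..i' - 1} - {i}. f l)"
    by simp
  then have "f i' \<le> 2 * e" using 1 2 by linarith
  moreover have "f i' > D" using assms(2) by (simp add: jump_at_def)
  ultimately show False using e by simp
qed

context heavy_tailed_walk
begin

text \<open>
  The window [w n, w' n] for S(n) is the state carried from one block to the next. It lies near the upper
  boundary of the cone, so that the average can decay by the factor 1/\<rho> before the next jump.
\<close>
definition in_window :: "real \<Rightarrow> real \<Rightarrow> nat \<Rightarrow> (nat \<Rightarrow> real) \<Rightarrow> bool"
  where "in_window w w' n f \<longleftrightarrow> in_cone n f \<and> (\<Sum>i=1..n. f i) \<in> {w * real n..w' * real n}"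

definition window_prob :: "real \<Rightarrow> real \<Rightarrow> nat \<Rightarrow> real"
  where "window_prob w w' n = prob {\<omega> \<in> space M. in_window w w' n (\<lambda>i. X i \<omega>)}"

lemma in_window_restrict: "in_window w w' n (restrict f {1..n}) = in_window w w' n f"
proof -
  have "(\<Sum>i=1..n. restrict f {1..n} i) = (\<Sum>i=1..n. f i)"
    by (intro sum.cong) auto
  then show ?thesis by (simp only: in_window_def in_cone_restrict)
qed

lemma sets_PiM_in_window:
  "{f \<in> space (PiM {1..n} (\<lambda>_. borel)). in_window w w' n f} \<in> sets (PiM {1..n} (\<lambda>_. borel))"
  unfolding in_window_def
  by (intro sets.sets_Collect_conj sets_PiM_in_cone sets_PiM_sum) auto

lemma sets_in_window: "{\<omega> \<in> space M. in_window w w' n (\<lambda>i. X i \<omega>)} \<in> events"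
  unfolding in_window_def
  by (intro sets.sets_Collect_conj sets_in_cone sets_sum) auto

lemma window_prob_le_persistence: "window_prob w w' n \<le> persistence n"
  unfolding window_prob_def persistence_def
  by (intro finite_measure_mono sets_in_cone) (auto simp: in_window_def)

text \<open>
  Before the jump S is nearly constant, and the window of time t is so high that the average stays above
  a until the end of the block. From the jump on S is already in the window of time t', and the average
  stays below b since the jump occurs late enough. The range of the jump is narrower by the fluctuation e
  at both ends than the increment of the window, so the window does not widen from block to block.
\<close>
lemma jump_keeps_window:
  assumes W: "in_window w w' t f" and J: "jump_at t t' D D' e i f"
    and i: "i \<in> {t<..t'}" and aw: "a \<le> w"
    and before: "a * real t' \<le> w * real t - e" "w' * real t + e \<le> b * real t"
    and after: "w' * real t' \<le> b * real i"
    and D: "w * (real t' - real t) + e \<le> D" "D' \<le> w' * (real t' - real t) - e"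
  shows "in_window w w' t' f"
proof -
  have St: "w * real t \<le> (\<Sum>i=1..t. f i)" "(\<Sum>i=1..t. f i) \<le> w' * real t"
    using W by (auto simp: in_window_def)
  have fi: "D < f i" "f i \<le> D'" using J by (auto simp: jump_at_def)
  have small: "\<bar>\<Sum>l\<in>{t<..k} - {i}. f l\<bar> \<le> e" if "k \<in> {t<..t'}" for k
    using J that by (auto simp: jump_at_def)
  have late: "w * real t' \<le> (\<Sum>i=1..k. f i) \<and> (\<Sum>i=1..k. f i) \<le> w' * real t'"
    if k: "k \<in> {i..t'}" for k
  proof -
    have "(\<Sum>l\<in>{t<..k}. f l) = f i + (\<Sum>l\<in>{t<..k} - {i}. f l)"
      using i k by (intro sum.remove) auto
    then have "(\<Sum>i=1..k. f i) = (\<Sum>i=1..t. f i) + f i + (\<Sum>l\<in>{t<..k} - {i}. f l)"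
      using sum_split_block[of t k f] i k by simp
    then show ?thesis
      using St fi small[of k] D i k by (simp add: algebra_simps abs_le_iff)
  qed
  have "(\<Sum>i=1..k. f i) \<in> {a * real k..b * real k}" if k: "k \<in> {1..t'}" for k
  proof -
    have ak: "a * real k \<le> a * real t'" using k ab by simp
    consider "k \<le> t" | "t < k" "k < i" | "i \<le> k" using i by force
    then show ?thesis
    proof cases
      case 1
      then show ?thesis using W k by (auto simp: in_window_def in_cone_def)
    next
      case 2
      then have "{t<..k} - {i} = {t<..k}" by auto
      then have "\<bar>\<Sum>l\<in>{t<..k}. f l\<bar> \<le> e" using small[of k] 2 i by auto
      moreover have "b * real t \<le> b * real k" using 2 ab by simp
      ultimately show ?thesis
        using sum_split_block[of t k f] 2 St before ak by (simp add: abs_le_iff)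
    next
      case 3
      then have "w * real t' \<le> (\<Sum>i=1..k. f i)" "(\<Sum>i=1..k. f i) \<le> w' * real t'"
        using late[of k] k by auto
      moreover have "a * real t' \<le> w * real t'" using aw by (intro mult_right_mono) auto
      moreover have "b * real i \<le> b * real k" using 3 ab by simp
      ultimately show ?thesis using after ak by simp
    qed
  qed
  then show ?thesis
    using late[of t'] i by (auto simp: in_window_def in_cone_def)
qed

lemma prob_jump_at:
  assumes i: "i \<in> {t<..t'}"
  shows "prob {\<omega> \<in> space M. jump_at t t' D D' e i (\<lambda>i. X i \<omega>)}
    = prob {\<omega> \<in> space M. X 1 \<omega> \<in> {D<..D'}} *
      prob {\<omega> \<in> space M. \<forall>B\<in>(\<lambda>k. {t<..k} - {i}) ` {t<..t'}. \<bar>\<Sum>l\<in>B. X l \<omega>\<bar> \<le> e}"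
proof -
  let ?P = "\<lambda>f. f i \<in> {D<..D'}"
  let ?Q = "\<lambda>f. \<forall>B\<in>(\<lambda>k. {t<..k} - {i}) ` {t<..t'}. (\<Sum>l\<in>B. f l) \<in> {- e..e}"
  let ?B = "{t<..t'} - {i}"
  have Q: "?Q f \<longleftrightarrow> (\<forall>B\<in>(\<lambda>k. {t<..k} - {i}) ` {t<..t'}. \<bar>\<Sum>l\<in>B. f l\<bar> \<le> e)" for f :: "nat \<Rightarrow> real"
    by (simp add: abs_le_iff minus_le_iff conj_commute)
  have "prob {\<omega> \<in> space M. ?P (\<lambda>i. X i \<omega>) \<and> ?Q (\<lambda>i. X i \<omega>)}
    = prob {\<omega> \<in> space M. ?P (\<lambda>i. X i \<omega>)} * prob {\<omega> \<in> space M. ?Q (\<lambda>i. X i \<omega>)}"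
  proof (rule prob_conj_disjoint_blocks[where A="{i}" and B="?B"])
    show "{f \<in> space (PiM {i} (\<lambda>_. borel)). ?P f} \<in> sets (PiM {i} (\<lambda>_. borel))"
      using sets_PiM_sum[of "{i}" "{i}" "{D<..D'}"] by simp
    show "{f \<in> space (PiM ?B (\<lambda>_. borel)). ?Q f} \<in> sets (PiM ?B (\<lambda>_. borel))"
      by (intro sets.sets_Collect_finite_All sets_PiM_sum) auto
    show "?Q (restrict f ?B) = ?Q f" for f
    proof (intro ball_cong refl)
      fix B assume "B \<in> (\<lambda>k. {t<..k} - {i}) ` {t<..t'}"
      then have "(\<Sum>l\<in>B. restrict f ?B l) = (\<Sum>l\<in>B. f l)" by (intro sum.cong) auto
      then show "((\<Sum>l\<in>B. restrict f ?B l) \<in> {- e..e}) = ((\<Sum>l\<in>B. f l) \<in> {- e..e})" by simp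
    qed
  qed (use i in auto)
  then show ?thesis
    using prob_X[of i "{D<..D'}"] i unfolding Q jump_at_def by simp
qed

lemma sets_jump_at:
  assumes i: "i \<in> {t<..t'}"
  shows "{\<omega> \<in> space M. jump_at t t' D D' e i (\<lambda>i. X i \<omega>)} \<in> events"
proof -
  have "{\<omega> \<in> space M. X i \<omega> \<in> {D<..D'} \<and>
      (\<forall>B\<in>(\<lambda>k. {t<..k} - {i}) ` {t<..t'}. (\<Sum>l\<in>B. X l \<omega>) \<in> {- e..e})} \<in> events"
    using sets_sum[of "{i}" "{D<..D'}"] i
    by (intro sets.sets_Collect_conj sets.sets_Collect_finite_All sets_sum) auto
  then show ?thesis by (simp add: jump_at_def abs_le_iff minus_le_iff conj_commute)
qed

lemma window_prob_block:
  assumes I: "I \<subseteq> {t<..t'}" and t: "t \<le> t'" and aw: "a \<le> w"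
    and before: "a * real t' \<le> w * real t - e" "w' * real t + e \<le> b * real t"
    and after: "\<And>i. i \<in> I \<Longrightarrow> w' * real t' \<le> b * real i"
    and D: "w * (real t' - real t) + e \<le> D" "D' \<le> w' * (real t' - real t) - e"
    and e: "e \<ge> 0" "2 * e \<le> D"
    and fluct: "\<And>i. i \<in> I \<Longrightarrow> 1 / 2 \<le> prob {\<omega> \<in> space M.
      \<forall>B\<in>(\<lambda>k. {t<..k} - {i}) ` {t<..t'}. \<bar>\<Sum>l\<in>B. X l \<omega>\<bar> \<le> e}"
  shows "window_prob w w' t * (real (card I) * (prob {\<omega> \<in> space M. X 1 \<omega> \<in> {D<..D'}} / 2))
    \<le> window_prob w w' t'"
proof -
  let ?W = "\<lambda>\<omega>. in_window w w' t (\<lambda>i. X i \<omega>)"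
  let ?J = "\<lambda>i \<omega>. jump_at t t' D D' e i (\<lambda>i. X i \<omega>)"
  let ?p = "prob {\<omega> \<in> space M. X 1 \<omega> \<in> {D<..D'}}"
  have fin: "finite I" using I finite_subset by blast
  have sJ: "{\<omega> \<in> space M. ?J i \<omega>} \<in> events" if "i \<in> I" for i
    using I that by (intro sets_jump_at) auto
  have sWJ: "{\<omega> \<in> space M. ?W \<omega> \<and> ?J i \<omega>} \<in> events" if "i \<in> I" for i
    by (intro sets.sets_Collect_conj sets_in_window sJ that)
  have one: "window_prob w w' t * (?p / 2) \<le> prob {\<omega> \<in> space M. ?W \<omega> \<and> ?J i \<omega>}"
    if i: "i \<in> I" for i
  proof -
    have it: "i \<in> {t<..t'}" using I i by auto
    have "?p * (1 / 2) \<le> prob {\<omega> \<in> space M. ?J i \<omega>}"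
      unfolding prob_jump_at[OF it] by (intro mult_left_mono fluct i) auto
    then have "window_prob w w' t * (?p / 2) \<le> window_prob w w' t * prob {\<omega> \<in> space M. ?J i \<omega>}"
      by (intro mult_left_mono) (auto simp: window_prob_def)
    also have "\<dots> = prob {\<omega> \<in> space M. ?W \<omega> \<and> ?J i \<omega>}"
      unfolding window_prob_def
    proof (rule prob_conj_disjoint_blocks[symmetric, OF _ _ _ sets_PiM_in_window in_window_restrict])
      show "{f \<in> space (PiM {t<..t'} (\<lambda>_. borel)). jump_at t t' D D' e i f}
          \<in> sets (PiM {t<..t'} (\<lambda>_. borel))"
      proof -
        have "{f \<in> space (PiM {t<..t'} (\<lambda>_. borel)). (\<Sum>l\<in>{i}. f l) \<in> {D<..D'} \<and>
          (\<forall>B\<in>(\<lambda>k. {t<..k} - {i}) ` {t<..t'}. (\<Sum>l\<in>B. f l) \<in> {- e..e})}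
          \<in> sets (PiM {t<..t'} (\<lambda>_. borel))"
          using it by (intro sets.sets_Collect_conj sets.sets_Collect_finite_All sets_PiM_sum) auto
        then show ?thesis by (simp add: jump_at_def abs_le_iff minus_le_iff conj_commute)
      qed
      show "jump_at t t' D D' e i (restrict f {t<..t'}) = jump_at t t' D D' e i f" for f
      proof -
        have "(\<Sum>l\<in>B. restrict f {t<..t'} l) = (\<Sum>l\<in>B. f l)"
          if "B \<in> (\<lambda>k. {t<..k} - {i}) ` {t<..t'}" for B
          using that by (intro sum.cong) auto
        then show ?thesis using it unfolding jump_at_def by simp
      qed
    qed auto
    finally show ?thesis .
  qed
  have "window_prob w w' t * (real (card I) * (?p / 2)) = (\<Sum>i\<in>I. window_prob w w' t * (?p / 2))"
    by simp
  also have "\<dots> \<le> (\<Sum>i\<in>I. prob {\<omega> \<in> space M. ?W \<omega> \<and> ?J i \<omega>})"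
    by (rule sum_mono[OF one])
  also have "\<dots> = prob (\<Union>i\<in>I. {\<omega> \<in> space M. ?W \<omega> \<and> ?J i \<omega>})"
  proof (rule finite_measure_finite_Union[symmetric, OF fin])
    show "disjoint_family_on (\<lambda>i. {\<omega> \<in> space M. ?W \<omega> \<and> ?J i \<omega>}) I"
      unfolding disjoint_family_on_def using jump_at_unique[OF _ _ _ e] I by blast
  qed (use sWJ in auto)
  also have "\<dots> \<le> window_prob w w' t'"
    unfolding window_prob_def
  proof (intro finite_measure_mono sets_in_window subsetI)
    fix \<omega> assume "\<omega> \<in> (\<Union>i\<in>I. {\<omega> \<in> space M. ?W \<omega> \<and> ?J i \<omega>})"
    then obtain i where i: "i \<in> I" "\<omega> \<in> space M" "?W \<omega>" "?J i \<omega>" by auto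
    have "in_window w w' t' (\<lambda>i. X i \<omega>)"
      using I i(1) by (intro jump_keeps_window[OF i(3,4) _ aw before after[OF i(1)] D]) auto
    with i show "\<omega> \<in> {\<omega> \<in> space M. in_window w w' t' (\<lambda>i. X i \<omega>)}" by simp
  qed
  finally show ?thesis .
qed

text \<open>
  The window [w, w'] has w > a \<rho>, which leaves room for the decay by the factor 1/\<rho>, and w' < b,
  which leaves a positive fraction 1 - z of the block for the jump. Each of these order t
  possible times contributes order t^(-beta).
\<close>
lemma persistence_step_lower:
  assumes \<rho>: "1 < \<rho>" and w: "a * \<rho> < w" "w < w'" "w' < b" and \<beta>: "\<beta> > \<alpha>"
  shows "\<exists>C>0. \<exists>j0. \<forall>j\<ge>j0. window_prob w w' (geom_time \<rho> (Suc j))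
    \<ge> window_prob w w' (geom_time \<rho> j) * (C * (\<rho> ^ j) powr (- (\<beta> - 1)))"
proof -
  \<comment> \<open>Per unit of t, the increment of the window over a block is [w (\<rho> - 1), w (\<rho> - 1) + g]; the middle third (d, d') is reserved for the jump and the fluctuation takes at most a sixth of g on each side.\<close>
  define g where "g = (w' - w) * (\<rho> - 1)"
  define \<epsilon> where "\<epsilon> = min (g / 6) (min ((w - a * \<rho>) / 2) (b - w'))"
  define d where "d = w * (\<rho> - 1) + g / 3"
  define d' where "d' = d + g / 3"
  \<comment> \<open>z = w'/b is late enough for the cone; the second term makes z \<rho> > 1, so that jumps after z t' fall into the block.\<close>
  define z where "z = max (w' / b) ((1 + 1 / \<rho>) / 2)"
  let ?t = "geom_time \<rho>"
  let ?R = "\<lambda>j. real (?t (Suc j)) / real (?t j)"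
  have b: "b > 0" using ab by simp
  have aw: "a < w" using w(1) \<rho> ab by (smt (verit) mult_less_cancel_left1)
  have g: "g > 0" using w \<rho> by (simp add: g_def)
  have \<epsilon>: "\<epsilon> > 0" "\<epsilon> \<le> g / 6" "\<epsilon> \<le> (w - a * \<rho>) / 2" "\<epsilon> \<le> b - w'"
    unfolding \<epsilon>_def using g w by (simp, intro min.coboundedI1 order_refl,
      intro min.coboundedI2 min.coboundedI1 order_refl, intro min.coboundedI2 order_refl)
  have wr: "w * (\<rho> - 1) > 0" using aw ab \<rho> by simp
  have d: "0 < d" "d < d'" "2 * \<epsilon> \<le> d" using g wr \<epsilon>(2) by (auto simp: d_def d'_def)
  have z: "w' / b \<le> z" "z < 1" "1 < z * \<rho>" "z > 0"
  proof -
    have "(1 + 1 / \<rho>) / 2 * \<rho> > 1" using \<rho> by (simp add: field_simps)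
    moreover have "(1 + 1 / \<rho>) / 2 * \<rho> \<le> z * \<rho>" unfolding z_def using \<rho> by (intro mult_right_mono) auto
    ultimately show "1 < z * \<rho>" by linarith
    then show "z > 0" using \<rho> by (smt (verit) mult_nonpos_nonneg)
    show "w' / b \<le> z" by (simp add: z_def)
    show "z < 1" using w b \<rho> by (simp add: z_def)
  qed
  obtain c x0 where c: "c > 0" and jump: "\<And>x. x \<ge> x0 \<Longrightarrow>
      prob {\<omega> \<in> space M. X 1 \<omega> \<in> {d * x<..d' * x}} \<ge> c * x powr (- \<beta>)"
    using jump_prob_ge[OF d(1,2) \<beta>] by blast
  define C where "C = (1 - z) * c / 2 * 2 powr (1 - \<beta>)"
  have C: "C > 0" using z c by (simp add: C_def)
  have R: "?R \<longlonglongrightarrow> \<rho>" by (rule geom_time_ratio[OF \<rho>])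
  have top: "filterlim ?t sequentially sequentially" by (rule geom_time_at_top[OF \<rho>])
  have top': "filterlim (\<lambda>j. ?t (Suc j)) sequentially sequentially"
    using top by (rule filterlim_compose[OF _ filterlim_Suc])
  have "\<epsilon> / (2 * \<rho>) > 0" using \<epsilon> \<rho> by simp
  from eventually_compose_filterlim[OF fluctuations_small[OF this] top']
  have ev_fluct: "\<forall>\<^sub>F j in sequentially. \<forall>A \<B>. A \<subseteq> {1..} \<longrightarrow> finite A \<longrightarrow> card A \<le> ?t (Suc j) \<longrightarrow>
    \<B> \<subseteq> Pow A \<longrightarrow> card \<B> \<le> ?t (Suc j) \<longrightarrow>
    prob {\<omega> \<in> space M. \<forall>B\<in>\<B>. \<bar>\<Sum>i\<in>B. X i \<omega>\<bar> \<le> \<epsilon> / (2 * \<rho>) * real (?t (Suc j))} \<ge> 1 / 2" .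
  have ev_x0: "\<forall>\<^sub>F j in sequentially. real (?t j) \<ge> x0"
    using filterlim_compose[OF filterlim_real_sequentially top] unfolding filterlim_at_top by blast
  have ev1: "\<forall>\<^sub>F j in sequentially. a * ?R j < w - \<epsilon>"
  proof (rule order_tendstoD(2))
    show "(\<lambda>j. a * ?R j) \<longlonglongrightarrow> a * \<rho>" by (intro tendsto_intros R)
    have "2 * \<epsilon> \<le> w - a * \<rho>" using \<epsilon>(3) by simp
    then show "a * \<rho> < w - \<epsilon>" using w(1) by linarith
  qed
  have ev2: "\<forall>\<^sub>F j in sequentially. w * (?R j - 1) + \<epsilon> < d"
  proof (rule order_tendstoD(2))
    show "(\<lambda>j. w * (?R j - 1) + \<epsilon>) \<longlonglongrightarrow> w * (\<rho> - 1) + \<epsilon>" by (intro tendsto_intros R)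
    show "w * (\<rho> - 1) + \<epsilon> < d" using \<epsilon>(2) g by (simp add: d_def)
  qed
  have ev3: "\<forall>\<^sub>F j in sequentially. w' * (?R j - 1) - \<epsilon> > d'"
  proof (rule order_tendstoD(1))
    show "(\<lambda>j. w' * (?R j - 1) - \<epsilon>) \<longlonglongrightarrow> w' * (\<rho> - 1) - \<epsilon>" by (intro tendsto_intros R)
    have "w' * (\<rho> - 1) = w * (\<rho> - 1) + g" by (simp add: g_def algebra_simps)
    then show "d' < w' * (\<rho> - 1) - \<epsilon>" using \<epsilon>(2) g by (simp add: d_def d'_def)
  qed
  have ev4: "\<forall>\<^sub>F j in sequentially. z * ?R j > 1"
  proof (rule order_tendstoD(1))
    show "(\<lambda>j. z * ?R j) \<longlonglongrightarrow> z * \<rho>" by (intro tendsto_intros R)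
  qed (rule z)
  have ev5: "\<forall>\<^sub>F j in sequentially. ?R j < 2 * \<rho>"
    using R \<rho> by (intro order_tendstoD(2)[OF R]) auto
  have "\<forall>\<^sub>F j in sequentially. window_prob w w' (?t (Suc j))
      \<ge> window_prob w w' (?t j) * (C * (\<rho> ^ j) powr (- (\<beta> - 1)))"
    using ev_fluct ev_x0 ev1 ev2 ev3 ev4 ev5
  proof eventually_elim
    case (elim j)
    define t where "t = ?t j"
    define t' where "t' = ?t (Suc j)"
    have tt: "t \<ge> 1" "t \<le> t'" "t' \<ge> 1"
      unfolding t_def t'_def using geom_time_bounds(4)[OF \<rho>] geom_time_mono[OF \<rho>] by auto
    then have tpos: "real t > 0" by simp
    define R where "R = real t' / real t"
    have t': "real t' = R * real t" using tt by (simp add: R_def)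
    note e = elim[folded t_def t'_def, folded R_def]
    define I where "I = {nat \<lceil>z * real t'\<rceil>..t'}"
    have I: "real t < real i \<and> z * real t' \<le> real i" if "i \<in> I" for i
    proof -
      have "z * real t' \<le> real i" using that by (simp add: I_def)
      moreover have "1 * real t < z * R * real t" using e(6) tpos by (intro mult_strict_right_mono) auto
      ultimately show ?thesis by (simp add: t' mult.assoc)
    qed
    then have It: "I \<subseteq> {t<..t'}" by (auto simp: I_def)
    have cardI: "real (card I) \<ge> (1 - z) * real t'"
    proof -
      have "z * real t' \<le> 1 * real t'" using z by (intro mult_right_mono) auto
      then have "nat \<lceil>z * real t'\<rceil> \<le> t'" by (simp add: nat_le_iff ceiling_le_iff)
      moreover have "real (nat \<lceil>z * real t'\<rceil>) \<le> z * real t' + 1"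
      proof -
        have "0 \<le> z * real t'" using z by simp
        then show ?thesis by linarith
      qed
      ultimately show ?thesis by (simp add: I_def of_nat_diff algebra_simps)
    qed
    have "window_prob w w' t * (real (card I) * (prob {\<omega> \<in> space M. X 1 \<omega> \<in> {d * real t<..d' * real t}} / 2))
      \<le> window_prob w w' t'"
    proof (rule window_prob_block[where e="\<epsilon> * real t"])
      show "a * real t' \<le> w * real t - \<epsilon> * real t"
        using mult_right_mono[OF less_imp_le[OF e(3)], of "real t"] tpos by (simp add: t' algebra_simps)
      show "w' * real t + \<epsilon> * real t \<le> b * real t"
        using mult_right_mono[OF \<epsilon>(4), of "real t"] tpos by (simp add: algebra_simps)
      show "w * (real t' - real t) + \<epsilon> * real t \<le> d * real t"
        using mult_right_mono[OF less_imp_le[OF e(4)], of "real t"] tpos by (simp add: t' algebra_simps)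
      show "d' * real t \<le> w' * (real t' - real t) - \<epsilon> * real t"
        using mult_right_mono[OF less_imp_le[OF e(5)], of "real t"] tpos by (simp add: t' algebra_simps)
      show "2 * (\<epsilon> * real t) \<le> d * real t"
        using mult_right_mono[OF d(3), of "real t"] tpos by (simp add: algebra_simps)
      show "0 \<le> \<epsilon> * real t" using \<epsilon>(1) by simp
      show "w' * real t' \<le> b * real i" if "i \<in> I" for i
      proof -
        have "w' / b * real t' \<le> z * real t'" using z(1) by (intro mult_right_mono) auto
        also have "\<dots> \<le> real i" using I[OF that] by simp
        finally show ?thesis using b by (simp add: field_simps)
      qed
      fix i assume i: "i \<in> I"
      let ?\<B> = "(\<lambda>k. {t<..k} - {i}) ` {t<..t'}"
      let ?F = "\<lambda>e. {\<omega> \<in> space M. \<forall>B\<in>?\<B>. \<bar>\<Sum>l\<in>B. X l \<omega>\<bar> \<le> e}"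
      have "card ?\<B> \<le> card {t<..t'}" by (rule card_image_le) simp
      then have "1 / 2 \<le> prob (?F (\<epsilon> / (2 * \<rho>) * real t'))"
        by (intro e(1)[rule_format, of "{t<..t'}" ?\<B>]) auto
      also have "\<dots> \<le> prob (?F (\<epsilon> * real t))"
      proof (intro finite_measure_mono)
        have "\<epsilon> / (2 * \<rho>) * real t' \<le> \<epsilon> * real t"
        proof -
          have "R * (\<epsilon> * real t) \<le> 2 * \<rho> * (\<epsilon> * real t)"
            using e(7) \<epsilon>(1) by (intro mult_right_mono) auto
          then show ?thesis using \<rho> by (simp add: t' field_simps)
        qed
        then show "?F (\<epsilon> / (2 * \<rho>) * real t') \<subseteq> ?F (\<epsilon> * real t)" by (auto intro: order_trans)
        have "{\<omega> \<in> space M. \<forall>B\<in>?\<B>. (\<Sum>l\<in>B. X l \<omega>) \<in> {- (\<epsilon> * real t)..\<epsilon> * real t}} \<in> events"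
          by (intro sets.sets_Collect_finite_All sets_sum) auto
        then show "?F (\<epsilon> * real t) \<in> events" by (simp add: abs_le_iff minus_le_iff conj_commute)
      qed
      finally show "1 / 2 \<le> prob (?F (\<epsilon> * real t))" .
    qed (use It tt aw in auto)
    moreover have "C * (\<rho> ^ j) powr (- (\<beta> - 1))
        \<le> real (card I) * (prob {\<omega> \<in> space M. X 1 \<omega> \<in> {d * real t<..d' * real t}} / 2)"
    proof -
      have "2 powr (1 - \<beta>) * (\<rho> ^ j) powr (1 - \<beta>) = (2 * \<rho> ^ j) powr (1 - \<beta>)"
        using \<rho> by (simp add: powr_mult)
      also have "\<dots> \<le> real t powr (1 - \<beta>)"
        using geom_time_bounds(3)[OF \<rho>, of j] tpos \<beta> \<alpha> by (intro powr_mono2') (auto simp: t_def)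
      also have "\<dots> = real t * real t powr (- \<beta>)"
        using tpos by (simp add: powr_diff powr_minus divide_inverse)
      finally have 1: "2 powr (1 - \<beta>) * (\<rho> ^ j) powr (1 - \<beta>) \<le> real t * real t powr (- \<beta>)" .
      have "C * (\<rho> ^ j) powr (- (\<beta> - 1)) = (1 - z) * c / 2 * (2 powr (1 - \<beta>) * (\<rho> ^ j) powr (1 - \<beta>))"
        by (simp add: C_def)
      also have "\<dots> \<le> (1 - z) * c / 2 * (real t * real t powr (- \<beta>))"
        using z c by (intro mult_left_mono 1) auto
      also have "\<dots> = ((1 - z) * real t) * (c * real t powr (- \<beta>) / 2)" by simp
      also have "\<dots> \<le> real (card I) * (prob {\<omega> \<in> space M. X 1 \<omega> \<in> {d * real t<..d' * real t}} / 2)"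
      proof (intro mult_mono divide_right_mono jump e(2))
        have "(1 - z) * real t \<le> (1 - z) * real t'" using z tt by (intro mult_left_mono) auto
        then show "(1 - z) * real t \<le> real (card I)" using cardI by simp
      qed (use c in auto)
      finally show ?thesis .
    qed
    then have "window_prob w w' t * (C * (\<rho> ^ j) powr (- (\<beta> - 1))) \<le> window_prob w w' t *
        (real (card I) * (prob {\<omega> \<in> space M. X 1 \<omega> \<in> {d * real t<..d' * real t}} / 2))"
      by (intro mult_left_mono) (auto simp: window_prob_def)
    ultimately show ?case unfolding t_def t'_def by linarith
  qed
  with C show ?thesis by (auto simp: eventually_sequentially)
qed

end

section \<open>Starting the jump strategy\<close>

context heavy_tailed_walk
begin

lemma charged_piece:
  assumes S: "prob {\<omega> \<in> space M. X 1 \<omega> \<in> S} > 0"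
    and I: "countable I" "\<And>i. i \<in> I \<Longrightarrow> A i \<in> sets borel" "S \<subseteq> (\<Union>i\<in>I. A i)"
  shows "\<exists>i\<in>I. prob {\<omega> \<in> space M. X 1 \<omega> \<in> A i} > 0"
proof (rule ccontr)
  assume "\<not> ?thesis"
  then have 0: "prob {\<omega> \<in> space M. X 1 \<omega> \<in> A i} = 0" if "i \<in> I" for i
    using that by (auto simp: not_less intro: antisym)
  have "{\<omega> \<in> space M. X 1 \<omega> \<in> A i} \<in> null_sets M" if "i \<in> I" for i
  proof -
    have "{\<omega> \<in> space M. X 1 \<omega> \<in> A i} \<in> events"
      using measurable_sets[OF measurable_X1(1) I(2)[OF that]]
      by (simp add: vimage_def Int_def conj_commute)
    then show ?thesis using 0[OF that] by (simp add: null_sets_def emeasure_eq_measure)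
  qed
  then have N: "(\<Union>i\<in>I. {\<omega> \<in> space M. X 1 \<omega> \<in> A i}) \<in> null_sets M"
    using I(1) by (rule null_sets_UN'[rotated])
  have "prob {\<omega> \<in> space M. X 1 \<omega> \<in> S} \<le> prob (\<Union>i\<in>I. {\<omega> \<in> space M. X 1 \<omega> \<in> A i})"
    using N I(3) by (intro finite_measure_mono) auto
  also have "\<dots> = 0" using N by (simp add: null_sets_def measure_def)
  finally show False using S by simp
qed

text \<open>
  The window must lie strictly above the part of (a, b) used for the start, since the walk enters it by an
  upward jump.
\<close>
lemma charged_below_b: "\<exists>v<b. prob {\<omega> \<in> space M. X 1 \<omega> \<in> {a<..v}} > 0"
proof -
  have "\<exists>n\<in>UNIV. prob {\<omega> \<in> space M. X 1 \<omega> \<in> {a<..b - 1 / real (Suc n)}} > 0"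
  proof (rule charged_piece[OF charged])
    show "{a<..<b} \<subseteq> (\<Union>n\<in>UNIV. {a<..b - 1 / real (Suc n)})"
    proof
      fix x assume x: "x \<in> {a<..<b}"
      then obtain n where "inverse (real (Suc n)) < b - x"
        using reals_Archimedean[of "b - x"] by auto
      with x have "x \<in> {a<..b - 1 / real (Suc n)}" by (simp add: inverse_eq_divide)
      then show "x \<in> (\<Union>n\<in>UNIV. {a<..b - 1 / real (Suc n)})" by blast
    qed
  qed auto
  then obtain n :: nat where "prob {\<omega> \<in> space M. X 1 \<omega> \<in> {a<..b - 1 / real (Suc n)}} > 0" by auto
  then show ?thesis by (intro exI[of _ "b - 1 / real (Suc n)"]) auto
qed

text \<open>
  The strategy must be started inside the window. All of the first n variables lie in one piece of
  (a, v] of length (w' - w)/4, which fixes S(n) up to a quarter of the width of the window, and one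
  jump of order n then carries the sum into the window at time n + 1.
\<close>
lemma window_prob_pos:
  assumes v: "prob {\<omega> \<in> space M. X 1 \<omega> \<in> {a<..v}} > 0" "v < w" and w: "a < w" "w < w'" "w' < b"
  shows "\<exists>n0. \<forall>n\<ge>n0. window_prob w w' n > 0"
proof -
  define \<delta> where "\<delta> = (w' - w) / 4"
  have \<delta>: "\<delta> > 0" "4 * \<delta> = w' - w" using w by (auto simp: \<delta>_def)
  let ?piece = "\<lambda>k :: int. {a<..v} \<inter> {of_int k * \<delta>..of_int (k + 1) * \<delta>}"
  have "\<exists>k\<in>UNIV. prob {\<omega> \<in> space M. X 1 \<omega> \<in> ?piece k} > 0"
  proof (rule charged_piece[OF v(1)])
    show "{a<..v} \<subseteq> (\<Union>k\<in>UNIV. ?piece k)"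
    proof
      fix x assume x: "x \<in> {a<..v}"
      have "of_int \<lfloor>x / \<delta>\<rfloor> \<le> x / \<delta>" "x / \<delta> \<le> of_int (\<lfloor>x / \<delta>\<rfloor> + 1)" by linarith+
      then have "of_int \<lfloor>x / \<delta>\<rfloor> * \<delta> \<le> x" "x \<le> of_int (\<lfloor>x / \<delta>\<rfloor> + 1) * \<delta>"
        using \<delta>(1) pos_le_divide_eq pos_divide_le_eq by blast+
      then have "x \<in> ?piece \<lfloor>x / \<delta>\<rfloor>" using x by simp
      then show "x \<in> (\<Union>k\<in>UNIV. ?piece k)" by blast
    qed
  qed auto
  then obtain k where k: "prob {\<omega> \<in> space M. X 1 \<omega> \<in> ?piece k} > 0" by auto
  define u where "u = of_int k * \<delta>"
  define S where "S = {a<..v} \<inter> {u..u + \<delta>}"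
  have S: "prob {\<omega> \<in> space M. X 1 \<omega> \<in> S} > 0"
    using k by (simp add: S_def u_def algebra_simps)
  have "S \<noteq> {}" using S by auto
  then have uv: "u \<le> v" by (auto simp: S_def)
  \<comment> \<open>From S(n) in [u n, (u + \<delta>) n], a jump in (d n, d' n] leads to a sum in [(w + \<delta>) n, w' n]; the spare \<delta> n absorbs the passage from n to n + 1.\<close>
  define d where "d = w - u + \<delta>"
  define d' where "d' = w - u + 3 * \<delta>"
  have d: "0 < d" "d < d'" using uv v(2) \<delta> by (auto simp: d_def d'_def)
  obtain c x0 where c: "c > 0" and jump: "\<And>x. x \<ge> x0 \<Longrightarrow>
      prob {\<omega> \<in> space M. X 1 \<omega> \<in> {d * x<..d' * x}} \<ge> c * x powr (- (\<alpha> + 1))"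
    using jump_prob_ge[OF d, of "\<alpha> + 1"] by auto
  have pos: "window_prob w w' (Suc n) > 0" if n: "n \<ge> 1" "real n \<ge> x0" "\<delta> * real n \<ge> w" for n
  proof -
    define A where "A i = (if i = Suc n then {d * real n<..d' * real n} else S)" for i
    have A: "A i \<in> sets borel" for i by (simp add: A_def S_def)
    let ?E = "\<Inter>i\<in>{1..Suc n}. X i -` A i \<inter> space M"
    have "prob ?E = (\<Prod>i\<in>{1..Suc n}. prob (X i -` A i \<inter> space M))"
      by (intro indep_varsD[OF indep] A) auto
    also have "\<dots> = (\<Prod>i\<in>{1..Suc n}. prob {\<omega> \<in> space M. X 1 \<omega> \<in> A i})"
    proof (rule prod.cong[OF refl])
      fix i assume "i \<in> {1..Suc n}"
      then have "prob {\<omega> \<in> space M. X i \<omega> \<in> A i} = prob {\<omega> \<in> space M. X 1 \<omega> \<in> A i}"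
        by (intro prob_X A) auto
      then show "prob (X i -` A i \<inter> space M) = prob {\<omega> \<in> space M. X 1 \<omega> \<in> A i}"
        by (simp add: vimage_def Int_def conj_commute)
    qed
    also have "\<dots> > 0"
    proof (rule prod_pos)
      have "0 < c * real n powr (- (\<alpha> + 1))" using c n(1) by simp
      then have "prob {\<omega> \<in> space M. X 1 \<omega> \<in> {d * real n<..d' * real n}} > 0"
        using jump[OF n(2)] by linarith
      then show "prob {\<omega> \<in> space M. X 1 \<omega> \<in> A i} > 0" for i
        using S by (simp add: A_def)
    qed
    finally have "0 < prob ?E" .
    also have "prob ?E \<le> window_prob w w' (Suc n)"
      unfolding window_prob_def
    proof (intro finite_measure_mono sets_in_window subsetI)
      fix \<omega> assume \<omega>: "\<omega> \<in> ?E"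
      have XS: "a \<le> X i \<omega> \<and> X i \<omega> \<le> v \<and> u \<le> X i \<omega> \<and> X i \<omega> \<le> u + \<delta>" if "i \<in> {1..n}" for i
      proof -
        have "i \<in> {1..Suc n}" "A i = S" using that by (auto simp: A_def)
        then have "X i \<omega> \<in> S" using \<omega> by blast
        then show ?thesis by (auto simp: S_def)
      qed
      have XJ: "d * real n < X (Suc n) \<omega>" "X (Suc n) \<omega> \<le> d' * real n"
      proof -
        have "X (Suc n) \<omega> \<in> A (Suc n)" using \<omega> by auto
        then show "d * real n < X (Suc n) \<omega>" "X (Suc n) \<omega> \<le> d' * real n" by (auto simp: A_def)
      qed
      have cone: "a * real k \<le> (\<Sum>i=1..k. X i \<omega>) \<and> (\<Sum>i=1..k. X i \<omega>) \<le> b * real k"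
        if k: "k \<in> {1..n}" for k
      proof -
        have "(\<Sum>i=1..k. a) \<le> (\<Sum>i=1..k. X i \<omega>)" "(\<Sum>i=1..k. X i \<omega>) \<le> (\<Sum>i=1..k. b)"
          using XS v(2) w k by (intro sum_mono; force)+
        then show ?thesis by (simp add: mult.commute)
      qed
      have "(\<Sum>i=1..n. u) \<le> (\<Sum>i=1..n. X i \<omega>)" "(\<Sum>i=1..n. X i \<omega>) \<le> (\<Sum>i=1..n. u + \<delta>)"
        using XS by (intro sum_mono; force)+
      then have Sn: "u * real n \<le> (\<Sum>i=1..n. X i \<omega>)" "(\<Sum>i=1..n. X i \<omega>) \<le> (u + \<delta>) * real n"
        by (simp_all add: mult.commute)
      have "w * real (Suc n) \<le> (\<Sum>i=1..Suc n. X i \<omega>)"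
      proof -
        have "w * real (Suc n) \<le> u * real n + d * real n"
          using n(3) by (simp add: d_def algebra_simps)
        then show ?thesis using Sn(1) XJ(1) by simp
      qed
      moreover have "(\<Sum>i=1..Suc n. X i \<omega>) \<le> w' * real (Suc n)"
      proof -
        have "(u + \<delta>) * real n + d' * real n = (w + 4 * \<delta>) * real n"
          by (simp add: d'_def algebra_simps)
        also have "\<dots> \<le> w' * real (Suc n)" using \<delta>(2) w ab by (simp add: algebra_simps)
        finally show ?thesis using Sn(2) XJ(2) by simp
      qed
      ultimately have win: "(\<Sum>i=1..Suc n. X i \<omega>) \<in> {w * real (Suc n)..w' * real (Suc n)}" by simp
      have "a * real (Suc n) \<le> w * real (Suc n)" "w' * real (Suc n) \<le> b * real (Suc n)"
        using w by (intro mult_right_mono; simp)+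
      with win have last: "a * real (Suc n) \<le> (\<Sum>i=1..Suc n. X i \<omega>)"
          "(\<Sum>i=1..Suc n. X i \<omega>) \<le> b * real (Suc n)"
        unfolding atLeastAtMost_iff by linarith+
      have "in_cone (Suc n) (\<lambda>i. X i \<omega>)"
        unfolding in_cone_def
      proof
        fix k assume "k \<in> {1..Suc n}"
        then consider "k \<in> {1..n}" | "k = Suc n" by force
        then show "(\<Sum>i=1..k. X i \<omega>) \<in> {a * real k..b * real k}"
          using cone[of k] last by cases auto
      qed
      with win \<omega> show "\<omega> \<in> {\<omega> \<in> space M. in_window w w' (Suc n) (\<lambda>i. X i \<omega>)}"
        by (auto simp: in_window_def)
    qed
    finally show ?thesis .
  qed
  have "\<forall>\<^sub>F n in sequentially. window_prob w w' (Suc n) > 0"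
  proof -
    have "filterlim (\<lambda>n. \<delta> * real n) at_top sequentially" using \<delta>(1) by real_asymp
    then have "\<forall>\<^sub>F n in sequentially. \<delta> * real n \<ge> w" unfolding filterlim_at_top by blast
    moreover have "\<forall>\<^sub>F n in sequentially. real n \<ge> x0"
      using filterlim_real_sequentially unfolding filterlim_at_top by blast
    ultimately show ?thesis
      using eventually_ge_at_top[of 1] by eventually_elim (rule pos)
  qed
  then have "\<forall>\<^sub>F n in sequentially. window_prob w w' n > 0"
    by (rule eventually_sequentially_Suc[THEN iffD1])
  then show ?thesis by (simp add: eventually_sequentially)
qed

section \<open>The limit\<close>

lemma log_persistence_lower:
  assumes \<rho>: "1 < \<rho>" "\<rho> < b / a" and \<beta>: "\<beta> > \<alpha>" and y: "y < - ((\<beta> - 1) / (2 * ln \<rho>))"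
  shows "\<forall>\<^sub>F n in sequentially. y < 1 / (ln (real n))\<^sup>2 * ln (persistence n)"
proof -
  obtain v where v: "v < b" "prob {\<omega> \<in> space M. X 1 \<omega> \<in> {a<..v}} > 0"
    using charged_below_b by blast
  have "a * \<rho> < b" using \<rho> ab by (simp add: less_divide_eq mult.commute)
  then obtain w where w: "max v (a * \<rho>) < w" "w < b" using v dense[of "max v (a * \<rho>)" b] by auto
  obtain w' where w': "w < w'" "w' < b" using dense w by blast
  have aw: "a < w" using w(1) \<rho> ab by (smt (verit) max_less_iff_conj mult_less_cancel_left1)
  obtain C j0 where C: "C > 0" "\<And>j. j \<ge> j0 \<Longrightarrow> window_prob w w' (geom_time \<rho> (Suc j))
      \<ge> window_prob w w' (geom_time \<rho> j) * (C * (\<rho> ^ j) powr (- (\<beta> - 1)))"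
    using persistence_step_lower[OF \<rho>(1) _ w' \<beta>] w by auto
  obtain n0 where n0: "\<And>n. n \<ge> n0 \<Longrightarrow> window_prob w w' n > 0"
    using window_prob_pos[OF v(2) _ aw w'] w by auto
  have "\<forall>\<^sub>F j in sequentially. geom_time \<rho> j \<ge> n0"
    using geom_time_at_top[OF \<rho>(1)] unfolding filterlim_at_top by blast
  then obtain j1 where j1: "\<And>j. j \<ge> j1 \<Longrightarrow> geom_time \<rho> j \<ge> n0"
    by (auto simp: eventually_sequentially)
  define j2 where "j2 = max j0 j1"
  have pos: "window_prob w w' (geom_time \<rho> j) > 0" if "j \<ge> j2" for j
    using that by (intro n0 j1) (simp add: j2_def)
  have step: "window_prob w w' (geom_time \<rho> (Suc j))
      \<ge> window_prob w w' (geom_time \<rho> j) * (C * (\<rho> ^ j) powr (- (\<beta> - 1)))" if "j \<ge> j2" for j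
    using that by (intro C(2)) (simp add: j2_def)
  obtain A B where AB: "\<And>J. J \<ge> j2 \<Longrightarrow> ln (window_prob w w' (geom_time \<rho> J))
      \<ge> A + B * real J + (- (\<beta> - 1) * ln \<rho> / 2) * (real J)\<^sup>2"
    using ln_product_ge[where u="\<lambda>j. window_prob w w' (geom_time \<rho> j)", OF \<rho>(1) C(1) pos step]
    by blast
  define J where "J n = nat \<lceil>ln (real n) / ln \<rho>\<rceil>" for n :: nat
  have J: "\<bar>real (J n) - ln (real n) / ln \<rho>\<bar> \<le> 1" if "n \<ge> 1" for n
  proof -
    have "ln (real n) / ln \<rho> \<ge> 0" using \<rho> that by simp
    then show ?thesis unfolding J_def by linarith
  qed
  have "\<forall>\<^sub>F n in sequentially.
      y < 1 / (ln (real n))\<^sup>2 * (A + B * real (J n) + (- (\<beta> - 1) * ln \<rho> / 2) * (real (J n))\<^sup>2)"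
    using quadratic_over_ln_square[OF \<rho>(1) J] y by (rule order_tendstoD(1))
  moreover have "\<forall>\<^sub>F n in sequentially. J n \<ge> j2" by (rule filterlim_ln_index[OF \<rho>(1) J])
  ultimately show ?thesis
    using eventually_ge_at_top[of 1]
  proof eventually_elim
    case (elim n)
    have "window_prob w w' (geom_time \<rho> (J n)) \<le> persistence (geom_time \<rho> (J n))"
      by (rule window_prob_le_persistence)
    also have "\<dots> \<le> persistence n"
      unfolding J_def by (intro persistence_antimono geom_time_ceiling_ge \<rho> elim)
    finally have "ln (window_prob w w' (geom_time \<rho> (J n))) \<le> ln (persistence n)"
      using pos[OF elim(2)] persistence_pos by simp
    with AB[OF elim(2)]
    have "A + B * real (J n) + (- (\<beta> - 1) * ln \<rho> / 2) * (real (J n))\<^sup>2 \<le> ln (persistence n)"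
      by (rule order_trans)
    then have "1 / (ln (real n))\<^sup>2 * (A + B * real (J n) + (- (\<beta> - 1) * ln \<rho> / 2) * (real (J n))\<^sup>2)
      \<le> 1 / (ln (real n))\<^sup>2 * ln (persistence n)"
      by (intro mult_left_mono) auto
    with elim(1) show ?case by simp
  qed
qed

text \<open>
  Along s -> 1 from below, the choices beta = 1 + s (alpha - 1), q = (b/a)^(1/s) in the upper bound and
  beta = 1 + (alpha - 1)/s, \<rho> = (b/a)^s in the lower bound give the constants s^2 \<theta> and \<theta>/s^2.
\<close>
lemma log_persistence_tendsto:
  "(\<lambda>n. 1 / (ln (real n))\<^sup>2 * ln (persistence n)) \<longlonglongrightarrow> - ((\<alpha> - 1) / (2 * (ln b - ln a)))"
proof (rule order_tendstoI)
  define l where "l = ln b - ln a"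
  define \<theta> where "\<theta> = (\<alpha> - 1) / (2 * l)"
  have l: "l > 0" using ab by (simp add: l_def)
  have \<theta>: "\<theta> > 0" using l \<alpha> by (simp add: \<theta>_def)
  have ratio: "b / a = exp l" using ab by (simp add: l_def exp_diff)
  have near1: "\<forall>\<^sub>F s in at_left 1. 0 < s \<and> s < (1 :: real)"
    using eventually_at_left_real[of 0 1] by auto
  {
    fix y assume "y > - ((\<alpha> - 1) / (2 * (ln b - ln a)))"
    then have y: "- (1\<^sup>2 * \<theta>) < y" by (simp add: \<theta>_def l_def)
    have "((\<lambda>s. - (s\<^sup>2 * \<theta>)) \<longlongrightarrow> - (1\<^sup>2 * \<theta>)) (at_left 1)" by (intro tendsto_intros)
    then have "\<forall>\<^sub>F s in at_left 1. - (s\<^sup>2 * \<theta>) < y" using y by (rule order_tendstoD(2))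
    with near1 have "\<forall>\<^sub>F s in at_left 1. (0 < s \<and> s < 1) \<and> - (s\<^sup>2 * \<theta>) < y"
      by (rule eventually_conj)
    then obtain s :: real where s: "0 < s" "s < 1" "- (s\<^sup>2 * \<theta>) < y"
      using eventually_happens'[OF trivial_limit_at_left_real] by blast
    have "s\<^sup>2 * \<theta> = (1 + s * (\<alpha> - 1) - 1) / (2 * ln (exp (l / s)))"
      using s l by (simp add: \<theta>_def power2_eq_square)
    moreover have "b / a < exp (l / s)" using s l by (simp add: ratio less_divide_eq)
    moreover have "s * (\<alpha> - 1) < 1 * (\<alpha> - 1)"
      using s \<alpha> by (intro mult_strict_right_mono) auto
    then have "s * (\<alpha> - 1) < \<alpha> - 1" by (simp only: mult_1)
    then have "1 + s * (\<alpha> - 1) < \<alpha>" by linarith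
    moreover have "1 < 1 + s * (\<alpha> - 1)" using s \<alpha> by simp
    ultimately show "\<forall>\<^sub>F n in sequentially. 1 / (ln (real n))\<^sup>2 * ln (persistence n) < y"
      using s(3) by (intro log_persistence_upper[of "exp (l / s)" "1 + s * (\<alpha> - 1)"]) auto
  }
  {
    fix y assume "y < - ((\<alpha> - 1) / (2 * (ln b - ln a)))"
    then have y: "y < - (\<theta> / 1\<^sup>2)" by (simp add: \<theta>_def l_def)
    have "((\<lambda>s. - (\<theta> / s\<^sup>2)) \<longlongrightarrow> - (\<theta> / 1\<^sup>2)) (at_left 1)" by (intro tendsto_intros) simp
    then have "\<forall>\<^sub>F s in at_left 1. y < - (\<theta> / s\<^sup>2)" using y by (rule order_tendstoD(1))
    with near1 have "\<forall>\<^sub>F s in at_left 1. (0 < s \<and> s < 1) \<and> y < - (\<theta> / s\<^sup>2)"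
      by (rule eventually_conj)
    then obtain s :: real where s: "0 < s" "s < 1" "y < - (\<theta> / s\<^sup>2)"
      using eventually_happens'[OF trivial_limit_at_left_real] by blast
    have "\<theta> / s\<^sup>2 = (1 + (\<alpha> - 1) / s - 1) / (2 * ln (exp (s * l)))"
      using s l by (simp add: \<theta>_def power2_eq_square)
    moreover have "exp (s * l) < b / a" "1 < exp (s * l)" using s l by (simp_all add: ratio)
    moreover have "\<alpha> < 1 + (\<alpha> - 1) / s"
    proof -
      have "(\<alpha> - 1) * s < (\<alpha> - 1) * 1" using s \<alpha> by (intro mult_strict_left_mono) auto
      then have "\<alpha> - 1 < (\<alpha> - 1) / s" using s by (simp add: less_divide_eq)
      then show ?thesis by simp
    qed
    ultimately show "\<forall>\<^sub>F n in sequentially. y < 1 / (ln (real n))\<^sup>2 * ln (persistence n)"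
      using s(3) by (intro log_persistence_lower[of "exp (s * l)" "1 + (\<alpha> - 1) / s"]) auto
  }
qed

end

theorem theorem2p3:
  fixes M :: "'a measure"
    and X :: "nat \<Rightarrow> 'a \<Rightarrow> real"
    and L :: "real \<Rightarrow> real"
    and \<alpha> a b :: real
  assumes "prob_space M"
    and "\<alpha> > 1"
    and "iid_on {1..} M X"
    and "integrable M (X 1)"
    and "prob_space.expectation M (X 1) = 0"
    and "slowly_varying L"
    and "\<And>x. x > 0 \<Longrightarrow> measure M {\<omega> \<in> space M. X 1 \<omega> > x} = x powr (- \<alpha>) * L x"
    and "Limsup at_top (\<lambda>x::real. ereal (measure M {\<omega> \<in> space M. X 1 \<omega> < - x}
                                      / measure M {\<omega> \<in> space M. X 1 \<omega> > x})) \<in> {0..<\<infinity>}"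
    and "0 < a" and "a < b"
    and "measure M {\<omega> \<in> space M. X 1 \<omega> \<in> {a<..<b}} > 0"
  shows "(\<lambda>n::nat. 1 / (ln (real n))\<^sup>2 *
            ln (measure M {\<omega> \<in> space M. \<forall>k\<in>{1..n}. (\<Sum>i=1..k. X i \<omega>) / real k \<in> {a..b}}))
         \<longlonglongrightarrow> - ((\<alpha> - 1) / (2 * (ln b - ln a)))"
proof -
  interpret heavy_tailed_walk M X L \<alpha> a b
    by (intro heavy_tailed_walk.intro iid_sequence.intro iid_sequence_axioms.intro
        heavy_tailed_walk_axioms.intro assms)
  have "{\<omega> \<in> space M. \<forall>k\<in>{1..n}. (\<Sum>i=1..k. X i \<omega>) / real k \<in> {a..b}}
      = {\<omega> \<in> space M. in_cone n (\<lambda>i. X i \<omega>)}" for n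
    by (auto simp: in_cone_def le_divide_eq divide_le_eq)
  then show ?thesis
    using log_persistence_tendsto by (simp only: persistence_def)
qed

end
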